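(* Let $T\ge 2$. Let $q(x_{1:T}\mid x_0)=\prod_{t=1}^T q(x_t\mid x_{t-1})$ be a forward Markov process and $p^\theta(x_{0:T})=p(x_T)\prod_{t=1}^T p^\theta(x_{t-1}\mid x_t)$ a parameterised reverse Markov process. Then for a data point $x_0$ the negative log-likelihood is bounded by $$-\log p^\theta(x_0)\;\le\;\mathcal L_T(x_0)+\mathcal L^\theta_{\mathrm{diff}}(x_0)+\mathcal L_0^\theta(x_0),$$ where $$\mathcal L_T(x_0)=D_{\mathrm{KL}}\bigl(q(x_T\mid x_0)\,\|\,p(x_T)\bigr),$$ $$\mathcal L^\theta_{\mathrm{diff}}(x_0)=\sum_{t=2}^T\mathbb E_{x_t\sim q(\cdot\mid x_0)}\Bigl[D_{\mathrm{KL}}\bigl(q(x_{t-1}\mid x_t,x_0)\,\|\,p^\theta(x_{t-1}\mid x_t)\bigr)\Bigr],$$ $$\mathcal L^\theta_0(x_0)=\mathbb E_{x_1\sim q(\cdot\mid x_0)}\bigl[-\log p^\theta(x_0\mid x_1)\bigr].$$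
   Context: The state space is $\mathcal X^d$ with $\mathcal X=\mathbb R$ (all $q(\cdot\mid\cdot)$, $p(\cdot)$, $p^\theta(\cdot\mid\cdot)$ are densities with respect to Lebesgue measure) or $\mathcal X=\{1,\dots,K\}$ (they are probability mass functions; integrals are sums). $p(x_T)$ is a fixed prior (noise) distribution. $p^\theta(x_0)=\int p^\theta(x_{0:T})\,dx_{1:T}$ is the model marginal likelihood. $q(x_t\mid x_0)$ is the marginal at time $t$ of the forward chain started at $x_0$, and $q(x_{t-1}\mid x_t,x_0)$ is the conditional distribution of $x_{t-1}$ given $x_t$ and $x_0$ under the forward chain. Densities are assumed such that all the logarithms, KL divergences and expectations involved are well defined (e.g. positive where needed and integrable). *)

theory Defs
  imports "HOL-Probability.Probability"
begin

text \<open>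
  A point of \<open>\<X>\<^sup>d\<close> is a function on \<open>{..<d}\<close> (extensional, as in the library's product measures).
  The alphabet \<open>{1, \<dots>, K}\<close> is embedded into the reals so that the continuous and the
  discrete case share one type.  The reference measure carries the state space: densities are taken
  with respect to it, and only their values on its \<open>space\<close> matter.
\<close>

definition state_measure :: "nat \<Rightarrow> (nat \<Rightarrow> real) measure \<Rightarrow> bool" where
  "state_measure d M \<longleftrightarrow>
     M = (\<Pi>\<^sub>M i\<in>{..<d}. lborel) \<or>
     (\<exists>K::nat. K \<ge> 1 \<and> M = count_space ({..<d} \<rightarrow>\<^sub>E real ` {1..K}))"

definition prob_density :: "'a measure \<Rightarrow> ('a \<Rightarrow> real) \<Rightarrow> bool" where
  "prob_density M f \<longleftrightarrow>
     f \<in> borel_measurable M \<and> (\<forall>x\<in>space M. 0 \<le> f x) \<and> (\<integral>\<^sup>+ x. ennreal (f x) \<partial>M) = 1"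

text \<open>In a transition density the conditioning variable comes first: \<open>k x y\<close> is \<open>k(y | x)\<close>.\<close>

definition transition_density :: "'a measure \<Rightarrow> ('a \<Rightarrow> 'a \<Rightarrow> real) \<Rightarrow> bool" where
  "transition_density M k \<longleftrightarrow>
     case_prod k \<in> borel_measurable (M \<Otimes>\<^sub>M M) \<and> (\<forall>x\<in>space M. prob_density M (k x))"

text \<open>
  \<open>q t x y\<close> is \<open>q(x\<^sub>t = y | x\<^sub>t\<^sub>-\<^sub>1 = x)\<close>.  Trajectories are functions of time whose value at time 0
  is the starting point; integration is over the remaining times only.
\<close>

definition forward_joint :: "(nat \<Rightarrow> 'a \<Rightarrow> 'a \<Rightarrow> real) \<Rightarrow> nat \<Rightarrow> (nat \<Rightarrow> 'a) \<Rightarrow> real" where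
  "forward_joint q T x = (\<Prod>t=1..T. q t (x (t - 1)) (x t))"

definition forward_marginal ::
    "'a measure \<Rightarrow> (nat \<Rightarrow> 'a \<Rightarrow> 'a \<Rightarrow> real) \<Rightarrow> nat \<Rightarrow> 'a \<Rightarrow> nat \<Rightarrow> 'a \<Rightarrow> real" where
  "forward_marginal M q T x0 t y =
     (\<integral>x. forward_joint q T (x(0 := x0, t := y)) \<partial>(\<Pi>\<^sub>M s\<in>{1..T} - {t}. M))"

text \<open>Joint density of \<open>(x\<^sub>t\<^sub>-\<^sub>1, x\<^sub>t)\<close> given \<open>x\<^sub>0\<close>; meaningful for \<open>2 \<le> t \<le> T\<close>.\<close>

definition forward_pair_marginal ::
    "'a measure \<Rightarrow> (nat \<Rightarrow> 'a \<Rightarrow> 'a \<Rightarrow> real) \<Rightarrow> nat \<Rightarrow> 'a \<Rightarrow> nat \<Rightarrow> 'a \<Rightarrow> 'a \<Rightarrow> real" where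
  "forward_pair_marginal M q T x0 t z y =
     (\<integral>x. forward_joint q T (x(0 := x0, t - 1 := z, t := y)) \<partial>(\<Pi>\<^sub>M s\<in>{1..T} - {t - 1, t}. M))"

text \<open>
  \<open>q(x\<^sub>t\<^sub>-\<^sub>1 = z | x\<^sub>t = y, x\<^sub>0)\<close>.  Division by zero yields 0, but the set of all \<open>y\<close> with vanishing
  marginal is null for the law of \<open>x\<^sub>t\<close>.
\<close>

definition forward_posterior ::
    "'a measure \<Rightarrow> (nat \<Rightarrow> 'a \<Rightarrow> 'a \<Rightarrow> real) \<Rightarrow> nat \<Rightarrow> 'a \<Rightarrow> nat \<Rightarrow> 'a \<Rightarrow> 'a \<Rightarrow> real" where
  "forward_posterior M q T x0 t y z =
     forward_pair_marginal M q T x0 t z y / forward_marginal M q T x0 t y"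

text \<open>\<open>r t x y\<close> is \<open>p\<^sup>\<theta>(x\<^sub>t\<^sub>-\<^sub>1 = y | x\<^sub>t = x)\<close>.\<close>

definition reverse_joint ::
    "('a \<Rightarrow> real) \<Rightarrow> (nat \<Rightarrow> 'a \<Rightarrow> 'a \<Rightarrow> real) \<Rightarrow> nat \<Rightarrow> (nat \<Rightarrow> 'a) \<Rightarrow> real" where
  "reverse_joint p r T x = p (x T) * (\<Prod>t=1..T. r t (x t) (x (t - 1)))"

definition model_likelihood ::
    "'a measure \<Rightarrow> ('a \<Rightarrow> real) \<Rightarrow> (nat \<Rightarrow> 'a \<Rightarrow> 'a \<Rightarrow> real) \<Rightarrow> nat \<Rightarrow> 'a \<Rightarrow> real" where
  "model_likelihood M p r T x0 =
     (\<integral>x. reverse_joint p r T (x(0 := x0)) \<partial>(\<Pi>\<^sub>M t\<in>{1..T}. M))"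

definition expect :: "'a measure \<Rightarrow> ('a \<Rightarrow> real) \<Rightarrow> ('a \<Rightarrow> real) \<Rightarrow> real" where
  "expect M f g = (\<integral>x. g x \<partial>(density M (\<lambda>x. ennreal (f x))))"

definition expect_exists :: "'a measure \<Rightarrow> ('a \<Rightarrow> real) \<Rightarrow> ('a \<Rightarrow> real) \<Rightarrow> bool" where
  "expect_exists M f g \<longleftrightarrow> integrable (density M (\<lambda>x. ennreal (f x))) g"

text \<open>
  \<open>D\<^sub>K\<^sub>L(f || g)\<close> in nats.  Beware that \<^const>\<open>KL_divergence\<close> takes the reference
  distribution \<open>g\<close> first.
\<close>

definition KL :: "'a measure \<Rightarrow> ('a \<Rightarrow> real) \<Rightarrow> ('a \<Rightarrow> real) \<Rightarrow> real" where
  "KL M f g =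
     KL_divergence (exp 1) (density M (\<lambda>x. ennreal (g x))) (density M (\<lambda>x. ennreal (f x)))"

text \<open>
  Since \<^const>\<open>KL_divergence\<close> is real valued, it represents the divergence only if
  \<open>f\<close> is absolutely continuous with respect to \<open>g\<close> and the log-ratio is integrable under \<open>f\<close>.
\<close>

definition KL_exists :: "'a measure \<Rightarrow> ('a \<Rightarrow> real) \<Rightarrow> ('a \<Rightarrow> real) \<Rightarrow> bool" where
  "KL_exists M f g \<longleftrightarrow>
     (AE x in M. g x = 0 \<longrightarrow> f x = 0) \<and> integrable M (\<lambda>x. f x * ln (f x / g x))"

definition loss_T ::
    "'a measure \<Rightarrow> (nat \<Rightarrow> 'a \<Rightarrow> 'a \<Rightarrow> real) \<Rightarrow> ('a \<Rightarrow> real) \<Rightarrow> nat \<Rightarrow> 'a \<Rightarrow> real" where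
  "loss_T M q p T x0 = KL M (forward_marginal M q T x0 T) p"

definition loss_diff ::
    "'a measure \<Rightarrow> (nat \<Rightarrow> 'a \<Rightarrow> 'a \<Rightarrow> real) \<Rightarrow> (nat \<Rightarrow> 'a \<Rightarrow> 'a \<Rightarrow> real) \<Rightarrow> nat \<Rightarrow> 'a \<Rightarrow> real" where
  "loss_diff M q r T x0 =
     (\<Sum>t=2..T. expect M (forward_marginal M q T x0 t)
        (\<lambda>y. KL M (forward_posterior M q T x0 t y) (r t y)))"

definition loss_0 ::
    "'a measure \<Rightarrow> (nat \<Rightarrow> 'a \<Rightarrow> 'a \<Rightarrow> real) \<Rightarrow> (nat \<Rightarrow> 'a \<Rightarrow> 'a \<Rightarrow> real) \<Rightarrow> nat \<Rightarrow> 'a \<Rightarrow> real" where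
  "loss_0 M q r T x0 = expect M (forward_marginal M q T x0 1) (\<lambda>y. - ln (r 1 y x0))"

text \<open>
  All logarithms, divergences and expectations in the bound exist (as real numbers).  Positivity of
  the densities is only required almost everywhere on the support of the forward process, so that
  forward kernels with zeros (e.g. absorbing ones) are admitted.
\<close>

definition bound_well_defined ::
    "'a measure \<Rightarrow> (nat \<Rightarrow> 'a \<Rightarrow> 'a \<Rightarrow> real) \<Rightarrow> ('a \<Rightarrow> real) \<Rightarrow> (nat \<Rightarrow> 'a \<Rightarrow> 'a \<Rightarrow> real) \<Rightarrow>
     nat \<Rightarrow> 'a \<Rightarrow> bool" where
  "bound_well_defined M q p r T x0 \<longleftrightarrow>
     integrable (\<Pi>\<^sub>M t\<in>{1..T}. M) (\<lambda>x. reverse_joint p r T (x(0 := x0))) \<and>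
     KL_exists M (forward_marginal M q T x0 T) p \<and>
     (\<forall>t\<in>{2..T}.
        (AE y in density M (\<lambda>y. ennreal (forward_marginal M q T x0 t y)).
           KL_exists M (forward_posterior M q T x0 t y) (r t y)) \<and>
        expect_exists M (forward_marginal M q T x0 t)
          (\<lambda>y. KL M (forward_posterior M q T x0 t y) (r t y))) \<and>
     (AE y in density M (\<lambda>y. ennreal (forward_marginal M q T x0 1 y)). 0 < r 1 y x0) \<and>
     expect_exists M (forward_marginal M q T x0 1) (\<lambda>y. - ln (r 1 y x0))"

end

theory Submission
  imports Defs
begin

text \<open>
  Write \<open>Q\<close> for the law of the forward path with density \<open>F\<close>, \<open>R\<close> for the reverse joint density and
  \<open>m\<^sub>t\<close> for the marginals of \<open>Q\<close>.  From \<open>ln u \<le> u - 1\<close> one gets \<open>- ln (\<integral>R) \<le> E\<^sub>Q[ln (F / R)]\<close>.  The Markov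
  property gives \<open>q(x\<^sub>t | x\<^sub>t\<^sub>-\<^sub>1) m\<^sub>t\<^sub>-\<^sub>1(x\<^sub>t\<^sub>-\<^sub>1) = q(x\<^sub>t\<^sub>-\<^sub>1 | x\<^sub>t, x\<^sub>0) m\<^sub>t(x\<^sub>t)\<close>, so \<open>F\<close> telescopes to
  \<open>m\<^sub>T(x\<^sub>T) \<Prod>\<^sub>t\<^sub>\<ge>\<^sub>2 q(x\<^sub>t\<^sub>-\<^sub>1 | x\<^sub>t, x\<^sub>0)\<close> almost surely, and \<open>ln (F / R)\<close> splits into the integrands of the three
  losses.  Splitting the expectation requires each summand to be \<open>Q\<close>-integrable.  For the posterior
  terms this holds because the negative part of a log-ratio has integral at most 1 for every
  conditioning value, so integrability of the conditional divergences controls the absolute values.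
\<close>

subsection \<open>Log-ratios of densities\<close>


text \<open>Jensen's inequality for the logarithm, via \<open>ln u \<le> u - 1\<close> at
  \<open>u = R / (F * Z)\<close>, where \<open>Z\<close> is the integral of \<open>R\<close>. Under
  the law with density \<open>F\<close> this \<open>u\<close> has expectation at most 1.
  Integrability of the log-ratio makes the right-hand side a genuine expectation.\<close>

lemma neg_ln_integral_le:
  fixes F R :: "'a \<Rightarrow> real"
  assumes [measurable]: "F \<in> borel_measurable N" "R \<in> borel_measurable N"
    and F: "\<And>x. x \<in> space N \<Longrightarrow> 0 \<le> F x" and R: "\<And>x. x \<in> space N \<Longrightarrow> 0 \<le> R x"
    and prob: "prob_space (density N (\<lambda>x. ennreal (F x)))"
    and intR: "integrable N R"
    and pos: "AE x in density N (\<lambda>x. ennreal (F x)). 0 < R x"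
    and intl: "integrable (density N (\<lambda>x. ennreal (F x))) (\<lambda>x. ln (F x / R x))"
  shows "- ln (\<integral>x. R x \<partial>N) \<le> (\<integral>x. ln (F x / R x) \<partial>density N (\<lambda>x. ennreal (F x)))"
proof -
  let ?Q = "density N (\<lambda>x. ennreal (F x))"
  define Z where "Z = (\<integral>x. R x \<partial>N)"
  interpret Q: prob_space ?Q by fact
  have Fpos: "AE x in ?Q. 0 < F x"
    by (subst AE_density) (auto simp: ennreal_zero_less_mult_iff)
  \<comment> \<open>If \<open>Z = 0\<close>, then \<open>R\<close> vanishes almost everywhere, hence
    also under \<open>?Q\<close>; this contradicts \<open>0 < R x\<close>, since \<open>?Q\<close>
    is a probability measure.\<close>
  have "Z \<noteq> 0"
  proof
    assume "Z = 0"
    then have "AE x in N. R x = 0"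
      unfolding Z_def using integral_nonneg_eq_0_iff_AE[OF intR] R by simp
    then have "AE x in ?Q. R x = 0"
      by (subst AE_density) auto
    with pos have "AE x in ?Q. False" by eventually_elim simp
    then show False by simp
  qed
  moreover have "0 \<le> Z" unfolding Z_def using R by (simp add: integral_nonneg_AE)
  ultimately have Z: "0 < Z" by simp
  \<comment> \<open>The integrand equals \<open>R x / Z\<close> where \<open>F x \<noteq> 0\<close>
    and, as division by zero yields 0, it is 0 elsewhere; so \<open>R x / Z\<close> dominates
    it.\<close>
  have int1: "integrable N (\<lambda>x. F x * (R x / (F x * Z)))"
  proof (rule Bochner_Integration.integrable_bound[of N "\<lambda>x. R x / Z"])
    show "AE x in N. norm (F x * (R x / (F x * Z))) \<le> norm (R x / Z)"
      using Z by (intro AE_I2) (auto simp: abs_mult)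
  qed (use intR in auto)
  have int2: "integrable ?Q (\<lambda>x. R x / (F x * Z))"
    using int1 F by (subst integrable_real_density) auto
  have "(\<integral>x. R x / (F x * Z) \<partial>?Q) = (\<integral>x. F x * (R x / (F x * Z)) \<partial>N)"
    using F by (subst integral_real_density) auto
  \<comment> \<open>Only an inequality: the mass that \<open>R\<close> has outside the support of
    \<open>F\<close> is lost.\<close>
  also have "\<dots> \<le> (\<integral>x. R x / Z \<partial>N)"
    using int1 intR Z R by (intro integral_mono) auto
  also have "\<dots> = 1" using Z by (simp add: Z_def)
  finally have le1: "(\<integral>x. R x / (F x * Z) \<partial>?Q) \<le> 1" .
  have "AE x in ?Q. - ln Z \<le> ln (F x / R x) + (R x / (F x * Z) - 1)"
    using pos Fpos
  proof eventually_elim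
    case (elim x)
    have "ln (R x / (F x * Z)) \<le> R x / (F x * Z) - 1"
      using elim Z by (intro ln_le_minus_one) auto
    then show ?case using elim Z by (simp add: ln_div ln_mult)
  qed
  then have "(\<integral>x. - ln Z \<partial>?Q) \<le> (\<integral>x. ln (F x / R x) + (R x / (F x * Z) - 1) \<partial>?Q)"
    using intl int2 by (intro integral_mono_AE) auto
  also have "\<dots> = (\<integral>x. ln (F x / R x) \<partial>?Q) + ((\<integral>x. R x / (F x * Z) \<partial>?Q) - 1)"
    using intl int2 Q.prob_space by simp
  finally show ?thesis using le1 Q.prob_space by (simp add: Z_def)
qed

lemma KL_eq_integral:
  assumes "sigma_finite_measure M"
    and "f \<in> borel_measurable M" "g \<in> borel_measurable M"
    and "\<And>x. x \<in> space M \<Longrightarrow> 0 \<le> f x" "\<And>x. x \<in> space M \<Longrightarrow> 0 \<le> g x"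
    and "KL_exists M f g"
  shows "KL M f g = (\<integral>x. f x * ln (f x / g x) \<partial>M)"
proof -
  have "KL M f g = (\<integral>x. f x * log (exp 1) (f x / g x) \<partial>M)"
    unfolding KL_def using assms
    by (intro sigma_finite_measure.KL_density_density) (auto simp: KL_exists_def)
  then show ?thesis by (simp add: log_def)
qed

text \<open>The negative part of \<open>f ln (f / g)\<close> is at most \<open>g\<close>.\<close>

lemma abs_mult_ln_div_le:
  fixes f g :: real
  assumes "0 \<le> f" "0 \<le> g" "g = 0 \<longrightarrow> f = 0"
  shows "\<bar>f * ln (f / g)\<bar> \<le> f * ln (f / g) + 2 * g"
proof (cases "f = 0")
  case False
  then have "0 < f" "0 < g" using assms by auto
  then have "ln (g / f) \<le> g / f - 1" by (intro ln_le_minus_one) auto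
  then have "f * ln (g / f) \<le> f * (g / f - 1)" using \<open>0 < f\<close> by (intro mult_left_mono) auto
  also have "\<dots> \<le> g" using \<open>0 < f\<close> by (simp add: field_simps)
  finally have "- (f * ln (f / g)) \<le> g" using \<open>0 < f\<close> \<open>0 < g\<close> by (simp add: ln_div algebra_simps)
  \<comment> \<open>\<open>\<bar>a\<bar>\<close> is \<open>a\<close> plus twice its negative part;
    hence the factor 2.\<close>
  then show ?thesis using \<open>0 < g\<close> by (simp add: abs_if)
qed (use assms in auto)

lemma expect_KL_eq_integral_density_pair:
  assumes sf: "sigma_finite_measure M"
    and m: "prob_density M m"
    and f[measurable]: "case_prod f \<in> borel_measurable (M \<Otimes>\<^sub>M M)"
    and f0: "\<And>y z. y \<in> space M \<Longrightarrow> z \<in> space M \<Longrightarrow> 0 \<le> f y z"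
    and g: "transition_density M g"
    and ex: "AE y in density M (\<lambda>y. ennreal (m y)). KL_exists M (f y) (g y)"
    and int: "expect_exists M m (\<lambda>y. KL M (f y) (g y))"
  defines "N \<equiv> density (M \<Otimes>\<^sub>M M) (\<lambda>w. ennreal (m (fst w) * f (fst w) (snd w)))"
  shows "AE w in N. 0 < g (fst w) (snd w)"
    and "integrable N (\<lambda>w. ln (f (fst w) (snd w) / g (fst w) (snd w)))"
    and "(\<integral>w. ln (f (fst w) (snd w) / g (fst w) (snd w)) \<partial>N) = expect M m (\<lambda>y. KL M (f y) (g y))"
proof -
  interpret sigma_finite_measure M by fact
  interpret P: pair_sigma_finite M M ..
  have [measurable]: "m \<in> borel_measurable M" and m0: "\<And>y. y \<in> space M \<Longrightarrow> 0 \<le> m y"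
    and m1: "(\<integral>\<^sup>+y. ennreal (m y) \<partial>M) = 1"
    using m by (auto simp: prob_density_def)
  have [measurable]: "case_prod g \<in> borel_measurable (M \<Otimes>\<^sub>M M)"
    and g0: "\<And>y z. y \<in> space M \<Longrightarrow> z \<in> space M \<Longrightarrow> 0 \<le> g y z"
    and g1: "\<And>y. y \<in> space M \<Longrightarrow> (\<integral>\<^sup>+z. ennreal (g y z) \<partial>M) = 1"
    using g by (auto simp: transition_density_def prob_density_def)
  have fM[measurable]: "f y \<in> borel_measurable M" and gM[measurable]: "g y \<in> borel_measurable M" 
    if "y \<in> space M" for y
    using measurable_Pair2[OF f that] measurable_Pair2[OF \<open>case_prod g \<in> _\<close> that] by simp_all
  have intm: "integrable M m"
    using m0 m1 by (intro integrableI_nonneg) auto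
  have intg: "integrable M (g y)" and intg1: "(\<integral>z. g y z \<partial>M) = 1" if "y \<in> space M" for y
  proof -
    show "integrable M (g y)"
      using that g0 g1 by (intro integrableI_nonneg) auto
    show "(\<integral>z. g y z \<partial>M) = 1"
      using that g0 g1 by (subst integral_eq_nn_integral) auto
  qed
  \<comment> \<open>Almost everywhere for the law of \<open>y\<close> becomes almost everywhere for
    \<open>M\<close> with the guard \<open>0 < m y\<close>; the steps below therefore treat
    \<open>m y = 0\<close> as a trivial case.\<close>
  have ex': "AE y in M. 0 < m y \<longrightarrow> KL_exists M (f y) (g y)"
    using ex by (subst (asm) AE_density) auto
  have ac: "AE y in M. AE z in M. 0 < m y * f y z \<longrightarrow> 0 < g y z"
    using ex' AE_space
  proof eventually_elim
    case (elim y)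
    show ?case
    proof (cases "0 < m y")
      case True
      with elim have "AE z in M. g y z = 0 \<longrightarrow> f y z = 0" by (simp add: KL_exists_def)
      then show ?thesis using AE_space
      proof eventually_elim
        case z: (elim z)
        then show ?case using g0[of y z] elim by force
      qed
    next
      case False
      with m0[of y] elim show ?thesis by auto
    qed
  qed
  have "AE w in M \<Otimes>\<^sub>M M. 0 < m (fst w) * f (fst w) (snd w) \<longrightarrow> 0 < g (fst w) (snd w)"
  proof (rule P.AE_pair_measure)
    show "AE y in M. AE z in M. 0 < m (fst (y, z)) * f (fst (y, z)) (snd (y, z)) 
      \<longrightarrow> 0 < g (fst (y, z)) (snd (y, z))"
      using ac by simp
  qed measurable
  then show "AE w in N. 0 < g (fst w) (snd w)"
    unfolding N_def by (subst AE_density) auto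
  let ?h = "\<lambda>w. m (fst w) * f (fst w) (snd w) * ln (f (fst w) (snd w) / g (fst w) (snd w))"
  let ?L = "\<lambda>y z. f y z * ln (f y z / g y z)"
  have intK: "integrable M (\<lambda>y. m y * KL M (f y) (g y))"
  proof -
    \<comment> \<open>Measurability of the divergence in \<open>y\<close> comes from the assumed
      existence of its expectation.\<close>
    have "(\<lambda>y. KL M (f y) (g y)) \<in> borel_measurable M"
      using int by (auto simp: expect_exists_def dest: borel_measurable_integrable)
    then show ?thesis
      using int unfolding expect_exists_def
      by (subst (asm) integrable_real_density) (auto simp: m0)
  qed
  have KLeq: "KL M (f y) (g y) = (\<integral>z. ?L y z \<partial>M)" if "y \<in> space M" "KL_exists M (f y) (g y)" for y
    using that f0 g0 by (intro KL_eq_integral sf) auto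
  \<comment> \<open>The constant 2 is the integral of \<open>2 * g y\<close>, from
    \<open>abs_mult_ln_div_le\<close>.\<close>
  have bound: "integrable M (\<lambda>z. \<bar>?L y z\<bar>) \<and> (\<integral>z. \<bar>?L y z\<bar> \<partial>M) \<le> KL M (f y) (g y) + 2"
    if y: "y \<in> space M" and K: "KL_exists M (f y) (g y)" for y
  proof
    have iL: "integrable M (?L y)" and "AE z in M. g y z = 0 \<longrightarrow> f y z = 0"
      using K by (auto simp: KL_exists_def)
    show "integrable M (\<lambda>z. \<bar>?L y z\<bar>)" using iL by simp
    have "AE z in M. \<bar>?L y z\<bar> \<le> ?L y z + 2 * g y z"
      using \<open>AE z in M. g y z = 0 \<longrightarrow> f y z = 0\<close> AE_space
      by eventually_elim (use y f0 g0 in \<open>auto intro!: abs_mult_ln_div_le\<close>)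
    then have "(\<integral>z. \<bar>?L y z\<bar> \<partial>M) \<le> (\<integral>z. ?L y z + 2 * g y z \<partial>M)"
      using iL intg[OF y] by (intro integral_mono_AE) auto
    also have "\<dots> = KL M (f y) (g y) + 2"
      using iL intg[OF y] intg1[OF y] KLeq[OF y K] by simp
    finally show "(\<integral>z. \<bar>?L y z\<bar> \<partial>M) \<le> KL M (f y) (g y) + 2" .
  qed
  \<comment> \<open>Fubini's criterion: the slices are integrable, and the integrals of their
    absolute values are dominated by \<open>m y * KL M (f y) (g y) + 2 * m y\<close>. Slices with
    \<open>m y = 0\<close> vanish identically.\<close>
  have inth: "integrable (M \<Otimes>\<^sub>M M) ?h"
  proof (rule P.Fubini_integrable)
    show "AE y in M. integrable M (\<lambda>z. ?h (y, z))"
      using ex' AE_space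
    proof eventually_elim
      case (elim y)
      show ?case
      proof (cases "0 < m y")
        case True
        then show ?thesis using elim by (auto simp: KL_exists_def mult.assoc)
      next
        case False
        then have "m y = 0" using m0[of y] elim by simp
        then show ?thesis by simp
      qed
    qed
    show "integrable M (\<lambda>y. \<integral>z. norm (?h (y, z)) \<partial>M)"
    proof (rule Bochner_Integration.integrable_bound)
      show "integrable M (\<lambda>y. m y * KL M (f y) (g y) + 2 * m y)"
        using intK intm by auto
      show "AE y in M. norm (\<integral>z. norm (?h (y, z)) \<partial>M) \<le> norm (m y * KL M (f y) (g y) + 2 * m y)"
        using ex' AE_space
      proof eventually_elim
        case (elim y)
        show ?case
        proof (cases "0 < m y")
          case True
          have "(\<integral>z. norm (?h (y, z)) \<partial>M) = m y * (\<integral>z. \<bar>?L y z\<bar> \<partial>M)"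
            using True by (simp add: abs_mult mult.assoc)
          also have "\<dots> \<le> m y * (KL M (f y) (g y) + 2)"
            using True elim bound[of y] by (intro mult_left_mono) auto
          finally have "(\<integral>z. norm (?h (y, z)) \<partial>M) \<le> m y * KL M (f y) (g y) + 2 * m y"
            by (simp add: algebra_simps)
          moreover have "0 \<le> (\<integral>z. norm (?h (y, z)) \<partial>M)" by (intro integral_nonneg_AE) simp
          ultimately show ?thesis by simp
        next
          case False
          then have "m y = 0" using m0[of y] elim by simp
          then show ?thesis by simp
        qed
      qed
    qed measurable
  qed measurable
  have mf0: "AE w in M \<Otimes>\<^sub>M M. 0 \<le> m (fst w) * f (fst w) (snd w)"
    using m0 f0 by (intro AE_I2) (auto simp: space_pair_measure)
  show "integrable N (\<lambda>w. ln (f (fst w) (snd w) / g (fst w) (snd w)))"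
    unfolding N_def using inth mf0 by (subst integrable_real_density) auto
  have "(\<integral>w. ln (f (fst w) (snd w) / g (fst w) (snd w)) \<partial>N) = (\<integral>w. ?h w \<partial>(M \<Otimes>\<^sub>M M))"
    unfolding N_def using mf0 by (subst integral_real_density) auto
  also have "\<dots> = (\<integral>y. \<integral>z. ?h (y, z) \<partial>M \<partial>M)"
    using P.integral_fst'[OF inth] by simp
  also have "\<dots> = (\<integral>y. m y * KL M (f y) (g y) \<partial>M)"
  proof (rule integral_cong_AE)
    show "AE y in M. (\<integral>z. ?h (y, z) \<partial>M) = m y * KL M (f y) (g y)"
      using ex' AE_space
    proof eventually_elim
      case (elim y)
      show ?case
      proof (cases "0 < m y")
        case True
        then show ?thesis using elim KLeq[of y] by (simp add: mult.assoc)
      next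
        case False
        then have "m y = 0" using m0[of y] elim by simp
        then show ?thesis by simp
      qed
    qed
  qed (use intK in \<open>auto dest: borel_measurable_integrable\<close>)
  also have "\<dots> = expect M m (\<lambda>y. KL M (f y) (g y))"
  proof -
    have "(\<lambda>y. KL M (f y) (g y)) \<in> borel_measurable M"
      using int by (auto simp: expect_exists_def dest: borel_measurable_integrable)
    then show ?thesis
      unfolding expect_def by (subst integral_real_density) (auto simp: m0)
  qed
  finally show "(\<integral>w. ln (f (fst w) (snd w) / g (fst w) (snd w)) \<partial>N) = expect M m (\<lambda>y. KL M (f y) (g y))" .
qed


subsection \<open>Marginal densities on product spaces\<close>

text \<open>Marginalisation in abstract form: \<open>f\<close> is \<open>F\<close> in split
  coordinates (kept, integrated out), and \<open>iter\<close> is Tonelli's theorem for that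
  splitting. The work lies in passing from the nonnegative integral to the real-valued one used to
  define the marginals.\<close>

lemma distr_density_eq_density_integral:
  fixes F :: "'a \<Rightarrow> real" and f :: "'b \<times> 'c \<Rightarrow> real"
  assumes "sigma_finite_measure K"
    and [measurable]: "X \<in> N \<rightarrow>\<^sub>M L" "f \<in> borel_measurable (L \<Otimes>\<^sub>M K)"
    and F: "\<And>x. x \<in> space N \<Longrightarrow> 0 \<le> F x" "integrable N F"
    and f: "\<And>w. w \<in> space (L \<Otimes>\<^sub>M K) \<Longrightarrow> 0 \<le> f w"
    and iter: "\<And>A. A \<in> sets L \<Longrightarrow>
      (\<integral>\<^sup>+x. ennreal (F x) * indicator A (X x) \<partial>N) = (\<integral>\<^sup>+y. \<integral>\<^sup>+x. ennreal (f (y, x)) * indicator A y \<partial>K \<partial>L)"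
  shows "distr (density N (\<lambda>x. ennreal (F x))) L X = density L (\<lambda>y. ennreal (\<integral>x. f (y, x) \<partial>K))"
proof -
  interpret K: sigma_finite_measure K by fact
  have [measurable]: "F \<in> borel_measurable N" using F by auto
  have "(\<integral>\<^sup>+y. \<integral>\<^sup>+x. ennreal (f (y, x)) \<partial>K \<partial>L) = (\<integral>\<^sup>+y. \<integral>\<^sup>+x. ennreal (f (y, x)) * indicator (space L) y \<partial>K \<partial>L)"
    by (intro nn_integral_cong) simp
  also have "\<dots> = (\<integral>\<^sup>+x. ennreal (F x) * indicator (space L) (X x) \<partial>N)"
    by (rule iter[symmetric]) simp
  also have "\<dots> = (\<integral>\<^sup>+x. ennreal (F x) \<partial>N)"
    using measurable_space[OF assms(2)] by (intro nn_integral_cong) simp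
  also have "\<dots> < \<infinity>"
    using F by (subst nn_integral_eq_integral) auto
  \<comment> \<open>Taking \<open>A = space L\<close> in \<open>iter\<close> gives finite total
    mass, so almost every slice integral is finite and agrees with the real-valued integral.\<close>
  finally have "AE y in L. (\<integral>\<^sup>+x. ennreal (f (y, x)) \<partial>K) \<noteq> \<infinity>"
    by (intro nn_integral_PInf_AE) auto
  then have eq: "AE y in L. (\<integral>\<^sup>+x. ennreal (f (y, x)) \<partial>K) = ennreal (\<integral>x. f (y, x) \<partial>K)"
    using AE_space
  proof eventually_elim
    case (elim y)
    then have "integrable K (\<lambda>x. f (y, x))" 
      using f by (intro integrableI_nonneg) (auto simp: space_pair_measure top.not_eq_extremum)
    then show ?case
      using elim f by (intro nn_integral_eq_integral) (auto simp: space_pair_measure)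
  qed
  show ?thesis
  proof (rule measure_eqI)
    fix A assume "A \<in> sets (distr (density N (\<lambda>x. ennreal (F x))) L X)"
    then have [measurable]: "A \<in> sets L" by simp
    have "emeasure (distr (density N (\<lambda>x. ennreal (F x))) L X) A
        = (\<integral>\<^sup>+x. ennreal (F x) * indicator A (X x) \<partial>N)"
      by (auto simp: emeasure_distr emeasure_density intro!: nn_integral_cong split: split_indicator)
    also have "\<dots> = (\<integral>\<^sup>+y. (\<integral>\<^sup>+x. ennreal (f (y, x)) \<partial>K) * indicator A y \<partial>L)"
      by (subst iter) (auto intro!: nn_integral_cong nn_integral_multc)
    also have "\<dots> = (\<integral>\<^sup>+y. ennreal (\<integral>x. f (y, x) \<partial>K) * indicator A y \<partial>L)"
      using eq by (intro nn_integral_cong_AE) auto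
    also have "\<dots> = emeasure (density L (\<lambda>y. ennreal (\<integral>x. f (y, x) \<partial>K))) A"
      by (subst emeasure_density) auto
    finally show "emeasure (distr (density N (\<lambda>x. ennreal (F x))) L X) A = \<dots>" .
  qed simp
qed

context product_sigma_finite
begin

text \<open>Tonelli's theorem with coordinate \<open>t\<close> isolated: \<open>x(t := y)\<close>
  reassembles a point from \<open>y\<close> and the remaining coordinates.\<close>

lemma
  fixes F :: "('i \<Rightarrow> 'a) \<Rightarrow> real"
  assumes I: "finite I" "t \<in> I"
    and F: "\<And>x. x \<in> space (Pi\<^sub>M I M) \<Longrightarrow> 0 \<le> F x" "integrable (Pi\<^sub>M I M) F"
  shows borel_measurable_integral_component:
      "(\<lambda>y. \<integral>x. F (x(t := y)) \<partial>Pi\<^sub>M (I - {t}) M) \<in> borel_measurable (M t)"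
    and distr_density_component:
      "distr (density (Pi\<^sub>M I M) (\<lambda>x. ennreal (F x))) (M t) (\<lambda>x. x t) =
        density (M t) (\<lambda>y. ennreal (\<integral>x. F (x(t := y)) \<partial>Pi\<^sub>M (I - {t}) M))"
proof -
  have ins: "I = insert t (I - {t})" using I by auto
  have [measurable]: "F \<in> borel_measurable (Pi\<^sub>M I M)" using F by auto
  have upd: "(\<lambda>w. (snd w)(t := fst w)) \<in> M t \<Otimes>\<^sub>M Pi\<^sub>M (I - {t}) M \<rightarrow>\<^sub>M Pi\<^sub>M I M"
    using ins by (intro measurable_fun_upd[where J = "I - {t}"]) auto
  have meas: "(\<lambda>w. F ((snd w)(t := fst w))) \<in> borel_measurable (M t \<Otimes>\<^sub>M Pi\<^sub>M (I - {t}) M)"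
    by (rule measurable_compose[OF upd]) measurable
  have K: "sigma_finite_measure (Pi\<^sub>M (I - {t}) M)" using I by (intro sigma_finite) auto
  show "(\<lambda>y. \<integral>x. F (x(t := y)) \<partial>Pi\<^sub>M (I - {t}) M) \<in> borel_measurable (M t)"
    using sigma_finite_measure.borel_measurable_lebesgue_integral[OF K,
        where N = "M t" and f = "\<lambda>y x. F (x(t := y))"] meas
    by (simp add: case_prod_beta')
  have "distr (density (Pi\<^sub>M I M) (\<lambda>x. ennreal (F x))) (M t) (\<lambda>x. x t) =
    density (M t) (\<lambda>y. ennreal (\<integral>x. (\<lambda>w. F ((snd w)(t := fst w))) (y, x) \<partial>Pi\<^sub>M (I - {t}) M))"
  proof (rule distr_density_eq_density_integral)
    show "sigma_finite_measure (Pi\<^sub>M (I - {t}) M)" by fact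
    show "(\<lambda>x. x t) \<in> Pi\<^sub>M I M \<rightarrow>\<^sub>M M t" using I by measurable
    show "(\<lambda>w. F ((snd w)(t := fst w))) \<in> borel_measurable (M t \<Otimes>\<^sub>M Pi\<^sub>M (I - {t}) M)" by fact
    show "0 \<le> F ((snd w)(t := fst w))" if "w \<in> space (M t \<Otimes>\<^sub>M Pi\<^sub>M (I - {t}) M)" for w
      using F measurable_space[OF upd that] by blast
    fix A assume [measurable]: "A \<in> sets (M t)"
    have "(\<integral>\<^sup>+x. ennreal (F x) * indicator A (x t) \<partial>Pi\<^sub>M (insert t (I - {t})) M) =
      (\<integral>\<^sup>+y. \<integral>\<^sup>+x. ennreal (F (x(t := y))) * indicator A ((x(t := y)) t) \<partial>Pi\<^sub>M (I - {t}) M \<partial>M t)"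
    proof (rule product_nn_integral_insert_rev)
      show "(\<lambda>x. ennreal (F x) * indicator A (x t)) \<in> borel_measurable (Pi\<^sub>M (insert t (I - {t})) M)"
        unfolding ins[symmetric] using I by measurable
    qed (use I in auto)
    then show "(\<integral>\<^sup>+x. ennreal (F x) * indicator A (x t) \<partial>Pi\<^sub>M I M) =
      (\<integral>\<^sup>+y. \<integral>\<^sup>+x. ennreal (F ((snd (y, x))(t := fst (y, x)))) * indicator A y \<partial>Pi\<^sub>M (I - {t}) M \<partial>M t)"
      unfolding ins[symmetric] by simp
  qed (use F in auto)
  then show "distr (density (Pi\<^sub>M I M) (\<lambda>x. ennreal (F x))) (M t) (\<lambda>x. x t) =
      density (M t) (\<lambda>y. ennreal (\<integral>x. F (x(t := y)) \<partial>Pi\<^sub>M (I - {t}) M))"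
    by simp
qed

text \<open>The same with two coordinates isolated. The pair is listed with \<open>t\<close> first,
  the conditioning variable of the posterior, and \<open>t\<close> is updated last, as in
  \<open>forward_pair_marginal\<close>.\<close>

lemma
  fixes F :: "('i \<Rightarrow> 'a) \<Rightarrow> real"
  assumes I: "finite I" "t \<in> I" "s \<in> I" "s \<noteq> t"
    and F: "\<And>x. x \<in> space (Pi\<^sub>M I M) \<Longrightarrow> 0 \<le> F x" "integrable (Pi\<^sub>M I M) F"
  shows borel_measurable_integral_component_pair:
      "(\<lambda>w. \<integral>x. F (x(s := snd w, t := fst w)) \<partial>Pi\<^sub>M (I - {s, t}) M) \<in> borel_measurable (M t \<Otimes>\<^sub>M M s)"
    and distr_density_component_pair:
      "distr (density (Pi\<^sub>M I M) (\<lambda>x. ennreal (F x))) (M t \<Otimes>\<^sub>M M s) (\<lambda>x. (x t, x s)) =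
        density (M t \<Otimes>\<^sub>M M s)
          (\<lambda>w. ennreal (\<integral>x. F (x(s := snd w, t := fst w)) \<partial>Pi\<^sub>M (I - {s, t}) M))"
proof -
  let ?J = "I - {s, t}"
  have ins: "I = insert t (insert s ?J)" using I by auto
  have [measurable]: "F \<in> borel_measurable (Pi\<^sub>M I M)" using F by auto
  have upd: "(\<lambda>w. (snd w)(s := snd (fst w), t := fst (fst w))) \<in>
      (M t \<Otimes>\<^sub>M M s) \<Otimes>\<^sub>M Pi\<^sub>M ?J M \<rightarrow>\<^sub>M Pi\<^sub>M I M"
    using I by (intro measurable_fun_upd[where J = "insert s ?J"] measurable_fun_upd[where J = ?J]) auto
  have meas: "(\<lambda>w. F ((snd w)(s := snd (fst w), t := fst (fst w))))
      \<in> borel_measurable ((M t \<Otimes>\<^sub>M M s) \<Otimes>\<^sub>M Pi\<^sub>M ?J M)"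
    by (rule measurable_compose[OF upd]) measurable
  have K: "sigma_finite_measure (Pi\<^sub>M ?J M)" using I by (intro sigma_finite) auto
  show "(\<lambda>w. \<integral>x. F (x(s := snd w, t := fst w)) \<partial>Pi\<^sub>M ?J M) \<in> borel_measurable (M t \<Otimes>\<^sub>M M s)"
    using sigma_finite_measure.borel_measurable_lebesgue_integral[OF K,
        where N = "M t \<Otimes>\<^sub>M M s" and f = "\<lambda>w x. F (x(s := snd w, t := fst w))"] meas
    by (simp add: case_prod_beta')
  have "distr (density (Pi\<^sub>M I M) (\<lambda>x. ennreal (F x))) (M t \<Otimes>\<^sub>M M s) (\<lambda>x. (x t, x s)) =
    density (M t \<Otimes>\<^sub>M M s)
      (\<lambda>y. ennreal (\<integral>x. (\<lambda>w. F ((snd w)(s := snd (fst w), t := fst (fst w)))) (y, x) \<partial>Pi\<^sub>M ?J M))"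
  proof (rule distr_density_eq_density_integral)
    show "sigma_finite_measure (Pi\<^sub>M ?J M)" by fact
    show "(\<lambda>x. (x t, x s)) \<in> Pi\<^sub>M I M \<rightarrow>\<^sub>M M t \<Otimes>\<^sub>M M s" using I by measurable
    show "(\<lambda>w. F ((snd w)(s := snd (fst w), t := fst (fst w))))
        \<in> borel_measurable ((M t \<Otimes>\<^sub>M M s) \<Otimes>\<^sub>M Pi\<^sub>M ?J M)" by fact
    show "0 \<le> F ((snd w)(s := snd (fst w), t := fst (fst w)))"
      if "w \<in> space ((M t \<Otimes>\<^sub>M M s) \<Otimes>\<^sub>M Pi\<^sub>M ?J M)" for w
      using F measurable_space[OF upd that] by blast
    fix A assume A[measurable]: "A \<in> sets (M t \<Otimes>\<^sub>M M s)"
    \<comment> \<open>Coordinate \<open>t\<close> is split off first and \<open>s\<close> second;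
      the two outer integrals then recombine into one over the product
      \<open>M t \<Otimes>\<^sub>M M s\<close>.\<close>
    let ?g = "\<lambda>x. ennreal (F x) * indicator A (x t, x s)"
    have g: "?g \<in> borel_measurable (Pi\<^sub>M I M)" using I by measurable
    have "(\<integral>\<^sup>+x. ?g x \<partial>Pi\<^sub>M I M) = (\<integral>\<^sup>+y. \<integral>\<^sup>+x. ?g (x(t := y)) \<partial>Pi\<^sub>M (insert s ?J) M \<partial>M t)"
      using g unfolding ins[symmetric]
      by (subst (1) ins, intro product_nn_integral_insert_rev) (use I ins in auto)
    also have "\<dots> = (\<integral>\<^sup>+y. \<integral>\<^sup>+z. \<integral>\<^sup>+x. ?g (x(s := z, t := y)) \<partial>Pi\<^sub>M ?J M \<partial>M s \<partial>M t)"
    proof (intro nn_integral_cong product_nn_integral_insert_rev)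
      fix y assume y: "y \<in> space (M t)"
      have "(\<lambda>x. x(t := y)) \<in> Pi\<^sub>M (insert s ?J) M \<rightarrow>\<^sub>M Pi\<^sub>M I M"
        using y ins by (intro measurable_fun_upd[where J = "insert s ?J"]) auto
      then show "(\<lambda>x. ?g (x(t := y))) \<in> borel_measurable (Pi\<^sub>M (insert s ?J) M)"
        by (rule measurable_compose[OF _ g])
    qed (use I in auto)
    also have "\<dots> = (\<integral>\<^sup>+y. \<integral>\<^sup>+z. \<integral>\<^sup>+x. ennreal (F (x(s := z, t := y))) * indicator A (y, z) \<partial>Pi\<^sub>M ?J M \<partial>M s \<partial>M t)"
      using I by simp
    also have "\<dots> = (\<integral>\<^sup>+w. \<integral>\<^sup>+x. ennreal (F (x(s := snd w, t := fst w))) * indicator A w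
        \<partial>Pi\<^sub>M ?J M \<partial>(M t \<Otimes>\<^sub>M M s))"
    proof -
      interpret K: sigma_finite_measure "Pi\<^sub>M ?J M" by fact
      note meas[measurable]
      have "(\<lambda>w. \<integral>\<^sup>+x. ennreal ((\<lambda>w. F ((snd w)(s := snd (fst w), t := fst (fst w)))) (w, x)) * indicator A w
        \<partial>Pi\<^sub>M ?J M) \<in> borel_measurable (M t \<Otimes>\<^sub>M M s)"
        by measurable
      from sigma_finite_measure.nn_integral_fst[OF sigma_finite_measures this] show ?thesis by simp
    qed
    finally show "(\<integral>\<^sup>+x. ennreal (F x) * indicator A (x t, x s) \<partial>Pi\<^sub>M I M) =
      (\<integral>\<^sup>+w. \<integral>\<^sup>+x. ennreal (F ((snd (w, x))(s := snd (fst (w, x)), t := fst (fst (w, x))))) * indicator A w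
        \<partial>Pi\<^sub>M ?J M \<partial>(M t \<Otimes>\<^sub>M M s))"
      by simp
  qed (use F in auto)
  then show "distr (density (Pi\<^sub>M I M) (\<lambda>x. ennreal (F x))) (M t \<Otimes>\<^sub>M M s) (\<lambda>x. (x t, x s)) =
      density (M t \<Otimes>\<^sub>M M s)
        (\<lambda>w. ennreal (\<integral>x. F (x(s := snd w, t := fst w)) \<partial>Pi\<^sub>M ?J M))"
    by simp
qed

end

subsection \<open>The law of the forward process\<close>

declare One_nat_def [simp del]

text \<open>Working over a sigma-finite reference measure treats Lebesgue and counting measure at
  once.\<close>

locale forward_process = sigma_finite_measure M
  for M :: "'a measure" +
  fixes q :: "nat \<Rightarrow> 'a \<Rightarrow> 'a \<Rightarrow> real" and T :: nat and x0 :: 'a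
  assumes transition: "\<And>t. t \<in> {1..T} \<Longrightarrow> transition_density M (q t)"
    and x0: "x0 \<in> space M"

sublocale forward_process \<subseteq> product_sigma_finite "\<lambda>_::nat. M" ..

context forward_process
begin

text \<open>Points of the product over \<open>{1..n}\<close> carry no state at time 0, so the update
  supplies it. The length \<open>n\<close> varies to allow induction over time.\<close>

definition path_density :: "nat \<Rightarrow> (nat \<Rightarrow> 'a) \<Rightarrow> real" where
  "path_density n x = forward_joint q n (x(0 := x0))"

definition path_law :: "nat \<Rightarrow> (nat \<Rightarrow> 'a) measure" where
  "path_law n = density (Pi\<^sub>M {1..n} (\<lambda>_. M)) (\<lambda>x. ennreal (path_density n x))"

abbreviation "marginal \<equiv> forward_marginal M q T x0"

abbreviation "posterior \<equiv> forward_posterior M q T x0"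

lemma sets_path_law[measurable_cong]: "sets (path_law n) = sets (Pi\<^sub>M {1..n} (\<lambda>_. M))"
  by (simp add: path_law_def)

lemma space_path_law: "space (path_law n) = space (Pi\<^sub>M {1..n} (\<lambda>_. M))"
  by (simp add: path_law_def)

lemma measurable_q: "t \<in> {1..T} \<Longrightarrow> (\<lambda>w. q t (fst w) (snd w)) \<in> borel_measurable (M \<Otimes>\<^sub>M M)"
  using transition[of t] by (simp add: transition_density_def case_prod_beta')

lemma q_nonneg: "t \<in> {1..T} \<Longrightarrow> y \<in> space M \<Longrightarrow> z \<in> space M \<Longrightarrow> 0 \<le> q t y z"
  using transition[of t] by (simp add: transition_density_def prob_density_def)

lemma nn_integral_q: "t \<in> {1..T} \<Longrightarrow> y \<in> space M \<Longrightarrow> (\<integral>\<^sup>+z. ennreal (q t y z) \<partial>M) = 1"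
  using transition[of t] by (simp add: transition_density_def prob_density_def)

text \<open>At time 0 the coordinate is the constant \<open>x0\<close>; reading coordinates this way
  lets the first transition be handled like all others.\<close>

lemma measurable_coordinate:
  "(t :: nat) \<le> n \<Longrightarrow> (\<lambda>x. (x(0 := x0)) t) \<in> Pi\<^sub>M {1..n} (\<lambda>_. M) \<rightarrow>\<^sub>M M"
proof (cases "t = 0")
  case False
  assume "t \<le> n"
  with False have "t \<in> {1..n}" by simp
  from measurable_component_singleton[OF this] show ?thesis using False by simp
qed (use x0 in simp)

lemmas coordinate_in_space = measurable_space[OF measurable_coordinate]

lemma measurable_path_density:
  assumes "n \<le> T"
  shows "path_density n \<in> borel_measurable (Pi\<^sub>M {1..n} (\<lambda>_. M))"
proof -
  have "(\<lambda>x. q t ((x(0 := x0)) (t - 1)) ((x(0 := x0)) t)) \<in> borel_measurable (Pi\<^sub>M {1..n} (\<lambda>_. M))"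
    if "t \<in> {1..n}" for t
  proof -
    have "(\<lambda>x. ((x(0 := x0)) (t - 1), (x(0 := x0)) t)) \<in> Pi\<^sub>M {1..n} (\<lambda>_. M) \<rightarrow>\<^sub>M M \<Otimes>\<^sub>M M"
      using that by (intro measurable_Pair measurable_coordinate) auto
    from measurable_compose[OF this measurable_q[of t]] show ?thesis using that assms by simp
  qed
  then show ?thesis unfolding path_density_def[abs_def] forward_joint_def
    by (intro borel_measurable_prod)
qed

lemma path_density_nonneg:
  assumes "n \<le> T" "x \<in> space (Pi\<^sub>M {1..n} (\<lambda>_. M))"
  shows "0 \<le> path_density n x"
  unfolding path_density_def forward_joint_def
  using assms by (intro prod_nonneg ballI q_nonneg coordinate_in_space[of _ n]) auto

section \<open>Disintegration and consistency of the path laws\<close>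

lemma path_density_Suc_upd:
  "path_density (Suc n) (x(Suc n := y)) = path_density n x * q (Suc n) ((x(0 := x0)) n) y"
proof -
  have "(\<Prod>t = 1..n. q t (((x(Suc n := y))(0 := x0)) (t - 1)) (((x(Suc n := y))(0 := x0)) t)) =
        (\<Prod>t = 1..n. q t ((x(0 := x0)) (t - 1)) ((x(0 := x0)) t))"
    by (intro prod.cong) auto
  then show ?thesis
    by (simp add: path_density_def forward_joint_def)
qed

text \<open>Tonelli's theorem for the last coordinate: the density of the longer path factors into
  that of its prefix and one transition out of the prefix's final state.\<close>

lemma nn_integral_path_law_Suc:
  assumes n: "Suc n \<le> T" and h[measurable]: "h \<in> borel_measurable (Pi\<^sub>M {1..Suc n} (\<lambda>_. M))"
  shows "(\<integral>\<^sup>+x. h x \<partial>path_law (Suc n)) =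
    (\<integral>\<^sup>+x. (\<integral>\<^sup>+y. ennreal (q (Suc n) ((x(0 := x0)) n) y) * h (x(Suc n := y)) \<partial>M) \<partial>path_law n)"
proof -
  note measurable_path_density[OF n, measurable]
  have [measurable]: "path_density n \<in> borel_measurable (Pi\<^sub>M {1..n} (\<lambda>_. M))"
    using n by (intro measurable_path_density) simp
  have ins: "{1..Suc n} = insert (Suc n) {1..n}" by auto
  have upd[measurable]: "(\<lambda>w. (fst w)(Suc n := snd w)) \<in> Pi\<^sub>M {1..n} (\<lambda>_. M) \<Otimes>\<^sub>M M \<rightarrow>\<^sub>M Pi\<^sub>M {1..Suc n} (\<lambda>_. M)"
    by (intro measurable_fun_upd[where J = "{1..n}"]) auto
  have [measurable]: "(\<lambda>w. q (Suc n) (((fst w)(0 := x0)) n) (snd w))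
      \<in> borel_measurable (Pi\<^sub>M {1..n} (\<lambda>_. M) \<Otimes>\<^sub>M M)"
  proof -
    have "(\<lambda>w. (((fst w)(0 := x0)) n, snd w)) \<in> Pi\<^sub>M {1..n} (\<lambda>_. M) \<Otimes>\<^sub>M M \<rightarrow>\<^sub>M M \<Otimes>\<^sub>M M"
      by (intro measurable_Pair measurable_compose[OF measurable_fst measurable_coordinate]) auto
    from measurable_compose[OF this measurable_q[of "Suc n"]] show ?thesis using n by simp
  qed
  have hupd[measurable]: "(\<lambda>w. h ((fst w)(Suc n := snd w))) \<in> borel_measurable (Pi\<^sub>M {1..n} (\<lambda>_. M) \<Otimes>\<^sub>M M)"
    by (rule measurable_compose[OF upd h])
  have "(\<integral>\<^sup>+x. h x \<partial>path_law (Suc n)) =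
      (\<integral>\<^sup>+x. ennreal (path_density (Suc n) x) * h x \<partial>Pi\<^sub>M (insert (Suc n) {1..n}) (\<lambda>_. M))"
    unfolding path_law_def by (subst nn_integral_density) (simp_all add: ins[symmetric])
  also have "\<dots> = (\<integral>\<^sup>+x. \<integral>\<^sup>+y. ennreal (path_density (Suc n) (x(Suc n := y))) * h (x(Suc n := y)) \<partial>M
      \<partial>Pi\<^sub>M {1..n} (\<lambda>_. M))"
    by (rule product_nn_integral_insert) (simp_all add: ins[symmetric])
  also have "\<dots> = (\<integral>\<^sup>+x. ennreal (path_density n x) *
      (\<integral>\<^sup>+y. ennreal (q (Suc n) ((x(0 := x0)) n) y) * h (x(Suc n := y)) \<partial>M) \<partial>Pi\<^sub>M {1..n} (\<lambda>_. M))"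
  proof (rule nn_integral_cong)
    fix x assume x: "x \<in> space (Pi\<^sub>M {1..n} (\<lambda>_. M))"
    have [measurable]: "(\<lambda>y. h (x(Suc n := y))) \<in> borel_measurable M"
      using measurable_Pair2[OF hupd x] by simp
    have [measurable]: "(\<lambda>y. q (Suc n) ((x(0 := x0)) n) y) \<in> borel_measurable M"
      using measurable_Pair2[OF measurable_q[of "Suc n"] coordinate_in_space[OF _ x, of n]] n by simp
    have "(\<integral>\<^sup>+y. ennreal (path_density (Suc n) (x(Suc n := y))) * h (x(Suc n := y)) \<partial>M) =
      (\<integral>\<^sup>+y. ennreal (path_density n x) * (ennreal (q (Suc n) ((x(0 := x0)) n) y) * h (x(Suc n := y))) \<partial>M)"
      using n x path_density_nonneg[of n x] coordinate_in_space[OF _ x, of n]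
      by (intro nn_integral_cong) (simp add: path_density_Suc_upd ennreal_mult q_nonneg mult.assoc del: fun_upd_apply)
    also have "\<dots> = ennreal (path_density n x) *
      (\<integral>\<^sup>+y. ennreal (q (Suc n) ((x(0 := x0)) n) y) * h (x(Suc n := y)) \<partial>M)"
      by (rule nn_integral_cmult) measurable
    finally show "(\<integral>\<^sup>+y. ennreal (path_density (Suc n) (x(Suc n := y))) * h (x(Suc n := y)) \<partial>M) = \<dots>" .
  qed
  also have "\<dots> = (\<integral>\<^sup>+x. (\<integral>\<^sup>+y. ennreal (q (Suc n) ((x(0 := x0)) n) y) * h (x(Suc n := y)) \<partial>M) \<partial>path_law n)"
    unfolding path_law_def by (rule nn_integral_density[symmetric]) measurable
  finally show ?thesis .
qed

text \<open>Kolmogorov consistency: the last transition integrates to one and the restricted path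
  does not see its target, so later steps can be removed one at a time.\<close>

lemma nn_integral_path_law_restrict:
  assumes "n \<le> m" "m \<le> T" and h: "h \<in> borel_measurable (Pi\<^sub>M {1..n} (\<lambda>_. M))"
  shows "(\<integral>\<^sup>+x. h (restrict x {1..n}) \<partial>path_law m) = (\<integral>\<^sup>+x. h x \<partial>path_law n)"
  using assms(1,2)
proof (induction m rule: dec_induct)
  case base
  show ?case
    by (intro nn_integral_cong) (auto simp: space_path_law space_PiM PiE_def extensional_restrict)
next
  case (step m)
  have "(\<lambda>x. restrict x {1..n}) \<in> Pi\<^sub>M {1..Suc m} (\<lambda>_. M) \<rightarrow>\<^sub>M Pi\<^sub>M {1..n} (\<lambda>_. M)"
    using step by (intro measurable_restrict_subset) auto
  then have "(\<integral>\<^sup>+x. h (restrict x {1..n}) \<partial>path_law (Suc m)) = (\<integral>\<^sup>+x. (\<integral>\<^sup>+y.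
      ennreal (q (Suc m) ((x(0 := x0)) m) y) * h (restrict (x(Suc m := y)) {1..n}) \<partial>M) \<partial>path_law m)"
    using step by (intro nn_integral_path_law_Suc measurable_compose[OF _ h]) auto
  also have "\<dots> = (\<integral>\<^sup>+x. h (restrict x {1..n}) \<partial>path_law m)"
  proof (rule nn_integral_cong)
    fix x assume "x \<in> space (path_law m)"
    then have x: "(x(0 := x0)) m \<in> space M"
      using coordinate_in_space[of m m x] by (simp add: space_path_law)
    have "restrict (x(Suc m := y)) {1..n} = restrict x {1..n}" for y
      using step by (auto simp: restrict_def)
    then have "(\<integral>\<^sup>+y. ennreal (q (Suc m) ((x(0 := x0)) m) y) * h (restrict (x(Suc m := y)) {1..n}) \<partial>M) =
       (\<integral>\<^sup>+y. ennreal (q (Suc m) ((x(0 := x0)) m) y) \<partial>M) * h (restrict x {1..n})"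
      using measurable_Pair2[OF measurable_q[of "Suc m"] x] step by (simp add: nn_integral_multc del: fun_upd_apply)
    also have "\<dots> = h (restrict x {1..n})"
      using x step by (subst nn_integral_q) auto
    finally show "(\<integral>\<^sup>+y. ennreal (q (Suc m) ((x(0 := x0)) m) y) * h (restrict (x(Suc m := y)) {1..n}) \<partial>M) = \<dots>" .
  qed
  also have "\<dots> = (\<integral>\<^sup>+x. h x \<partial>path_law n)"
    using step.prems by (intro step.IH) simp
  finally show ?case .
qed

text \<open>Consistency reduces the total mass to length 0, where the product space is a single
  point and the density is the empty product 1.\<close>

lemma prob_space_path_law: "n \<le> T \<Longrightarrow> prob_space (path_law n)"
proof
  assume "n \<le> T"
  then have "(\<integral>\<^sup>+x. 1 \<partial>path_law n) = (\<integral>\<^sup>+x. 1 \<partial>path_law 0)"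
    using nn_integral_path_law_restrict[of 0 n "\<lambda>_. 1"] by simp
  also have "\<dots> = 1"
    by (simp add: path_law_def nn_integral_density path_density_def forward_joint_def emeasure_density PiM_empty)
  finally show "emeasure (path_law n) (space (path_law n)) = 1" by simp
qed

lemma integrable_path_density: "integrable (Pi\<^sub>M {1..T} (\<lambda>_. M)) (path_density T)"
proof -
  have "(\<integral>\<^sup>+x. ennreal (path_density T x) \<partial>Pi\<^sub>M {1..T} (\<lambda>_. M)) = 1"
    using prob_space.emeasure_space_1[OF prob_space_path_law[of T]] measurable_path_density[of T]
    by (simp add: path_law_def emeasure_density cong: nn_integral_cong)
  then show ?thesis
    using measurable_path_density[of T] path_density_nonneg[of T]
    by (intro integrableI_nonneg) auto
qed

text \<open>The Markov property in integrated form. The path is shortened to end at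
  \<open>Suc n\<close>, the last state is integrated out, and the path is lengthened again, so that
  both sides live under the full law. The case \<open>n = 0\<close> is included and starts from
  \<open>x0\<close>.\<close>

lemma nn_integral_path_law_step:
  assumes n: "Suc n \<le> T" and h: "h \<in> borel_measurable (M \<Otimes>\<^sub>M M)"
  shows "(\<integral>\<^sup>+x. h ((x(0 := x0)) n, x (Suc n)) \<partial>path_law T) =
    (\<integral>\<^sup>+x. (\<integral>\<^sup>+y. ennreal (q (Suc n) ((x(0 := x0)) n) y) * h ((x(0 := x0)) n, y) \<partial>M) \<partial>path_law T)"
proof -
  have 1: "(\<lambda>x. h ((x(0 := x0)) n, x (Suc n))) \<in> borel_measurable (Pi\<^sub>M {1..Suc n} (\<lambda>_. M))"
    by (intro measurable_compose[OF _ h] measurable_Pair measurable_coordinate) auto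
  have [measurable]: "(\<lambda>w. q (Suc n) (fst w) (snd w)) \<in> borel_measurable (M \<Otimes>\<^sub>M M)"
    using n by (intro measurable_q) auto
  note h[measurable]
  have "(\<lambda>z. \<integral>\<^sup>+y. ennreal ((\<lambda>w. q (Suc n) (fst w) (snd w)) (z, y)) * h (z, y) \<partial>M) \<in> borel_measurable M"
    by measurable
  from measurable_compose[OF measurable_coordinate[of n n] this]
  have 2: "(\<lambda>x. \<integral>\<^sup>+y. ennreal (q (Suc n) ((x(0 := x0)) n) y) * h ((x(0 := x0)) n, y) \<partial>M)
      \<in> borel_measurable (Pi\<^sub>M {1..n} (\<lambda>_. M))" by simp
  have r: "((restrict x {1..n})(0 := x0)) n = (x(0 := x0)) n"
      "((restrict x {1..Suc n})(0 := x0)) n = (x(0 := x0)) n"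
      "(restrict x {1..Suc n}) (Suc n) = x (Suc n)"
      "((x(Suc n := y))(0 := x0)) n = (x(0 := x0)) n" "(x(Suc n := y)) (Suc n) = y" for x y
    by auto
  have "(\<integral>\<^sup>+x. h ((x(0 := x0)) n, x (Suc n)) \<partial>path_law T) = (\<integral>\<^sup>+x. h ((x(0 := x0)) n, x (Suc n)) \<partial>path_law (Suc n))"
    using nn_integral_path_law_restrict[OF n order.refl 1] unfolding r .
  also have "\<dots> = (\<integral>\<^sup>+x. (\<integral>\<^sup>+y. ennreal (q (Suc n) ((x(0 := x0)) n) y) * h ((x(0 := x0)) n, y) \<partial>M) \<partial>path_law n)"
    unfolding nn_integral_path_law_Suc[OF n 1] r ..
  also have "\<dots> = (\<integral>\<^sup>+x. (\<integral>\<^sup>+y. ennreal (q (Suc n) ((x(0 := x0)) n) y) * h ((x(0 := x0)) n, y) \<partial>M) \<partial>path_law T)"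
    using nn_integral_path_law_restrict[OF _ order.refl 2] n unfolding r by simp
  finally show ?thesis .
qed

section \<open>One-time and two-time marginals of the path law\<close>

abbreviation "pair_marginal \<equiv> forward_pair_marginal M q T x0"

lemma measurable_path_law_component:
  "t \<in> {1..T} \<Longrightarrow> (\<lambda>x. x t) \<in> path_law T \<rightarrow>\<^sub>M M"
  unfolding path_law_def by (auto intro: measurable_component_singleton)

lemma measurable_path_law_pair:
  assumes "t \<in> {2..T}"
  shows "(\<lambda>x. (x t, x (t - 1))) \<in> path_law T \<rightarrow>\<^sub>M M \<Otimes>\<^sub>M M"
  using assms by (intro measurable_Pair measurable_path_law_component) auto

lemma path_density_upd:
  "t \<noteq> 0 \<Longrightarrow> path_density T (x(t := y)) = forward_joint q T (x(0 := x0, t := y))"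
  by (simp add: path_density_def fun_upd_twist)

lemma path_density_upd_pair:
  "t \<in> {2..T} \<Longrightarrow>
    path_density T (x(t - 1 := z, t := y)) = forward_joint q T (x(0 := x0, t - 1 := z, t := y))"
proof -
  assume "t \<in> {2..T}"
  \<comment> \<open>The lower limit 2 on \<open>t\<close> keeps \<open>t - 1\<close> away from 0, so
    the updates do not clash with the pinned starting point.\<close>
  then have "t \<noteq> 0" "t - 1 \<noteq> 0" by auto
  then have "x(t - 1 := z, t := y, 0 := x0) = x(0 := x0, t - 1 := z, t := y)"
    by (auto simp: fun_eq_iff)
  then show ?thesis by (simp add: path_density_def)
qed

lemma measurable_marginal: "t \<in> {1..T} \<Longrightarrow> marginal t \<in> borel_measurable M"
  and distr_marginal: "t \<in> {1..T} \<Longrightarrow>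
    distr (path_law T) M (\<lambda>x. x t) = density M (\<lambda>y. ennreal (marginal t y))"
proof -
  assume t: "t \<in> {1..T}"
  have eq: "(\<integral>x. path_density T (x(t := y)) \<partial>Pi\<^sub>M ({1..T} - {t}) (\<lambda>_. M)) = marginal t y" for y
    using t by (simp add: forward_marginal_def path_density_upd)
  show "marginal t \<in> borel_measurable M"
    using borel_measurable_integral_component[of "{1..T}" t "path_density T"]
      integrable_path_density path_density_nonneg t unfolding eq by auto
  show "distr (path_law T) M (\<lambda>x. x t) = density M (\<lambda>y. ennreal (marginal t y))"
    using distr_density_component[of "{1..T}" t "path_density T"]
      integrable_path_density path_density_nonneg t unfolding eq path_law_def by auto
qed

text \<open>The pair is ordered as (later, earlier), matching the arguments of the posterior,
  whereas the pair marginal takes the earlier state first; hence the exchange of \<open>fst\<close>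
  and \<open>snd\<close>.\<close>

lemma measurable_pair_marginal: "t \<in> {2..T} \<Longrightarrow>
    (\<lambda>w. pair_marginal t (snd w) (fst w)) \<in> borel_measurable (M \<Otimes>\<^sub>M M)"
  and distr_pair_marginal: "t \<in> {2..T} \<Longrightarrow>
    distr (path_law T) (M \<Otimes>\<^sub>M M) (\<lambda>x. (x t, x (t - 1))) =
      density (M \<Otimes>\<^sub>M M) (\<lambda>w. ennreal (pair_marginal t (snd w) (fst w)))"
proof -
  assume t: "t \<in> {2..T}"
  then have I: "finite {1..T}" "t \<in> {1..T}" "t - 1 \<in> {1..T}" "t - 1 \<noteq> t" by auto
  have eq: "(\<integral>x. path_density T (x(t - 1 := z, t := y)) \<partial>Pi\<^sub>M ({1..T} - {t - 1, t}) (\<lambda>_. M))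
      = pair_marginal t z y" for z y
    using t by (simp add: forward_pair_marginal_def path_density_upd_pair)
  show "(\<lambda>w. pair_marginal t (snd w) (fst w)) \<in> borel_measurable (M \<Otimes>\<^sub>M M)"
    using borel_measurable_integral_component_pair[OF I, of "path_density T"]
      integrable_path_density path_density_nonneg unfolding eq by auto
  show "distr (path_law T) (M \<Otimes>\<^sub>M M) (\<lambda>x. (x t, x (t - 1))) =
      density (M \<Otimes>\<^sub>M M) (\<lambda>w. ennreal (pair_marginal t (snd w) (fst w)))"
    using distr_density_component_pair[OF I, of "path_density T"]
      integrable_path_density path_density_nonneg unfolding eq path_law_def by auto
qed

lemma marginal_nonneg:
  assumes "t \<in> {1..T}" "y \<in> space M"
  shows "0 \<le> marginal t y"
  unfolding forward_marginal_def
proof (intro integral_nonneg_AE AE_I2)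
  fix x assume x: "x \<in> space (Pi\<^sub>M ({1..T} - {t}) (\<lambda>_. M))"
  have "x(t := y) \<in> space (Pi\<^sub>M {1..T} (\<lambda>_. M))"
    using x assms by (auto simp: space_PiM PiE_iff extensional_def)
  then show "0 \<le> forward_joint q T (x(0 := x0, t := y))"
    using path_density_nonneg[of T "x(t := y)"] assms by (simp add: path_density_upd)
qed

lemma pair_marginal_nonneg:
  assumes "t \<in> {2..T}" "y \<in> space M" "z \<in> space M"
  shows "0 \<le> pair_marginal t z y"
  unfolding forward_pair_marginal_def
proof (intro integral_nonneg_AE AE_I2)
  fix x assume x: "x \<in> space (Pi\<^sub>M ({1..T} - {t - 1, t}) (\<lambda>_. M))"
  have "x(t - 1 := z, t := y) \<in> space (Pi\<^sub>M {1..T} (\<lambda>_. M))"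
    using x assms by (auto simp: space_PiM PiE_iff extensional_def)
  then show "0 \<le> forward_joint q T (x(0 := x0, t - 1 := z, t := y))"
    using path_density_nonneg[of T "x(t - 1 := z, t := y)"] path_density_upd_pair[OF assms(1)] by simp
qed

lemma prob_density_marginal: "t \<in> {1..T} \<Longrightarrow> prob_density M (marginal t)"
proof -
  assume t: "t \<in> {1..T}"
  interpret P: prob_space "path_law T" by (rule prob_space_path_law) simp
  have "emeasure (density M (\<lambda>y. ennreal (marginal t y))) (space M) = 1"
    unfolding distr_marginal[OF t, symmetric]
    using prob_space.emeasure_space_1[OF P.prob_space_distr[OF measurable_path_law_component[OF t]]] by simp
  then show ?thesis
    using measurable_marginal[OF t] marginal_nonneg[OF t]
    by (simp add: prob_density_def emeasure_density cong: nn_integral_cong)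
qed

lemma posterior_nonneg:
  "t \<in> {2..T} \<Longrightarrow> y \<in> space M \<Longrightarrow> z \<in> space M \<Longrightarrow> 0 \<le> posterior t y z"
  by (auto simp: forward_posterior_def intro!: divide_nonneg_nonneg marginal_nonneg pair_marginal_nonneg)

lemma measurable_posterior:
  assumes t: "t \<in> {2..T}"
  shows "case_prod (posterior t) \<in> borel_measurable (M \<Otimes>\<^sub>M M)"
proof -
  have [measurable]: "marginal t \<in> borel_measurable M"
    using t by (intro measurable_marginal) auto
  note measurable_pair_marginal[OF t, measurable]
  show ?thesis by (simp add: forward_posterior_def case_prod_beta')
qed

lemma AE_path_law_marginal:
  assumes "t \<in> {1..T}" "AE y in density M (\<lambda>y. ennreal (marginal t y)). P y"
  shows "AE x in path_law T. P (x t)"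
  using assms(2) unfolding distr_marginal[OF assms(1), symmetric]
  by (rule AE_distrD[OF measurable_path_law_component[OF assms(1)]])

lemma AE_path_law_pair_marginal:
  assumes "t \<in> {2..T}"
    and "AE w in density (M \<Otimes>\<^sub>M M) (\<lambda>w. ennreal (pair_marginal t (snd w) (fst w))). P w"
  shows "AE x in path_law T. P (x t, x (t - 1))"
  using assms(2) unfolding distr_pair_marginal[OF assms(1), symmetric]
  by (rule AE_distrD[OF measurable_path_law_pair[OF assms(1)]])

section \<open>Reverse-time factorisation of the forward density\<close>

lemma AE_marginal_pos: "t \<in> {1..T} \<Longrightarrow> AE x in path_law T. 0 < marginal t (x t)"
  using measurable_marginal[of t]
  by (intro AE_path_law_marginal) (auto simp: AE_density ennreal_zero_less_mult_iff)

lemma AE_path_density_pos: "AE x in path_law T. 0 < path_density T x"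
  using measurable_path_density[of T] unfolding path_law_def
  by (auto simp: AE_density)

text \<open>Base case of the telescoping. Both functions are densities of the law of
  \<open>x 1\<close>, so uniqueness of densities identifies them almost everywhere.\<close>

lemma AE_marginal_1:
  assumes "1 \<le> T"
  shows "AE x in path_law T. marginal 1 (x 1) = q 1 x0 (x 1)"
proof -
  have T: "1 \<in> {1..T}" using assms by simp
  have [measurable]: "q 1 x0 \<in> borel_measurable M"
    using transition[OF T] x0 by (simp add: transition_density_def prob_density_def)
  note measurable_marginal[OF T, measurable]
  have eq: "density M (\<lambda>y. ennreal (marginal 1 y)) = density M (\<lambda>y. ennreal (q 1 x0 y))"
    unfolding distr_marginal[OF T, symmetric]
  proof (rule measure_eqI)
    fix A assume "A \<in> sets (distr (path_law T) M (\<lambda>x. x 1))"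
    then have A[measurable]: "A \<in> sets M" by simp
    interpret P: prob_space "path_law T" by (rule prob_space_path_law) simp
    have "emeasure (distr (path_law T) M (\<lambda>x. x 1)) A = (\<integral>\<^sup>+x. indicator A x \<partial>distr (path_law T) M (\<lambda>x. x 1))"
      by simp
    also have "\<dots> = (\<integral>\<^sup>+x. indicator A (x 1) \<partial>path_law T)"
      by (rule nn_integral_distr[OF measurable_path_law_component[OF T]]) simp
    \<comment> \<open>Here the step starts at time 0, so the inner integral is the same for every
      path and the outer one multiplies it by total mass one.\<close>
    also have "\<dots> = (\<integral>\<^sup>+x. (\<integral>\<^sup>+y. ennreal (q 1 x0 y) * indicator A y \<partial>M) \<partial>path_law T)"
      using nn_integral_path_law_step[of 0 "\<lambda>w. indicator A (snd w)"] assms by (simp add: One_nat_def[symmetric])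
    also have "\<dots> = emeasure (density M (\<lambda>y. ennreal (q 1 x0 y))) A"
      using P.emeasure_space_1 by (simp add: emeasure_density)
    finally show "emeasure (distr (path_law T) M (\<lambda>x. x 1)) A = \<dots>" .
  qed simp
  have "AE y in M. ennreal (marginal 1 y) = ennreal (q 1 x0 y)"
    by (rule density_unique[OF _ _ eq]) measurable
  then have "AE y in M. marginal 1 y = q 1 x0 y"
    using AE_space
  proof eventually_elim
    case (elim y)
    then show ?case using marginal_nonneg[OF T, of y] q_nonneg[OF T x0, of y] by simp
  qed
  then have "AE y in density M (\<lambda>y. ennreal (marginal 1 y)). marginal 1 y = q 1 x0 y"
    by (subst AE_density) auto
  then show ?thesis by (rule AE_path_law_marginal[OF T])
qed

text \<open>The Markov property, obtained by comparing two densities of the law of \<open>(x\<^sub>t, x\<^sub>t\<^sub>-\<^sub>1)\<close>.\<close>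

lemma AE_pair_marginal:
  assumes t: "t \<in> {2..T}"
  shows "AE x in path_law T. pair_marginal t (x (t - 1)) (x t) =
    marginal (t - 1) (x (t - 1)) * q t (x (t - 1)) (x t)"
proof -
  interpret P: pair_sigma_finite M M ..
  have t1: "t - 1 \<in> {1..T}" and t0: "t \<in> {1..T}" and St: "Suc (t - 1) = t" "t - 1 \<noteq> 0" using t by auto
  note [measurable] = measurable_marginal[OF t1] measurable_pair_marginal[OF t]
  have [measurable]: "(\<lambda>w. q t (snd w) (fst w)) \<in> borel_measurable (M \<Otimes>\<^sub>M M)"
    using measurable_compose[OF measurable_Pair[OF measurable_snd measurable_fst] measurable_q[OF t0]]
    by simp
  have q'[measurable]: "(\<lambda>w. q t (fst w) (snd w)) \<in> borel_measurable (M \<Otimes>\<^sub>M M)"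
    by (rule measurable_q[OF t0])
  let ?g = "\<lambda>w. marginal (t - 1) (snd w) * q t (snd w) (fst w)"
  have eq: "density (M \<Otimes>\<^sub>M M) (\<lambda>w. ennreal (pair_marginal t (snd w) (fst w))) =
      density (M \<Otimes>\<^sub>M M) (\<lambda>w. ennreal (?g w))"
    unfolding distr_pair_marginal[OF t, symmetric]
  proof (rule measure_eqI)
    let ?D = "distr (path_law T) (M \<Otimes>\<^sub>M M) (\<lambda>x. (x t, x (t - 1)))"
    fix A assume "A \<in> sets ?D"
    then have A[measurable]: "A \<in> sets (M \<Otimes>\<^sub>M M)" by simp
    let ?k = "\<lambda>z. \<integral>\<^sup>+y. ennreal (q t z y) * indicator A (y, z) \<partial>M"
    have "(\<lambda>z. \<integral>\<^sup>+y. ennreal ((\<lambda>w. q t (fst w) (snd w)) (z, y)) * indicator A (y, z) \<partial>M) \<in> borel_measurable M"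
      by measurable
    then have k[measurable]: "?k \<in> borel_measurable M" by simp
    have "emeasure ?D A = (\<integral>\<^sup>+x. indicator A x \<partial>?D)"
      by simp
    also have "\<dots> = (\<integral>\<^sup>+x. indicator A (x t, x (t - 1)) \<partial>path_law T)"
      by (rule nn_integral_distr[OF measurable_path_law_pair[OF t]]) simp
    \<comment> \<open>Integrates out \<open>x t\<close> given its predecessor; as
      \<open>t - 1 \<noteq> 0\<close>, the pinned path and the path agree there.\<close>
    also have "\<dots> = (\<integral>\<^sup>+x. ?k (x (t - 1)) \<partial>path_law T)"
      using nn_integral_path_law_step[of "t - 1" "\<lambda>w. indicator A (snd w, fst w)"] t St by simp
    also have "\<dots> = (\<integral>\<^sup>+z. ?k z \<partial>distr (path_law T) M (\<lambda>x. x (t - 1)))"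
      by (rule nn_integral_distr[OF measurable_path_law_component[OF t1], symmetric]) simp
    also have "\<dots> = (\<integral>\<^sup>+z. ennreal (marginal (t - 1) z) * ?k z \<partial>M)"
      unfolding distr_marginal[OF t1] by (rule nn_integral_density) measurable
    also have "\<dots> = (\<integral>\<^sup>+z. \<integral>\<^sup>+y. ennreal (?g (y, z)) * indicator A (y, z) \<partial>M \<partial>M)"
    proof (rule nn_integral_cong)
      fix z assume z: "z \<in> space M"
      have [measurable]: "q t z \<in> borel_measurable M"
        using measurable_Pair2[OF q' z] by simp
      have "ennreal (marginal (t - 1) z) * ?k z =
          (\<integral>\<^sup>+y. ennreal (marginal (t - 1) z) * (ennreal (q t z y) * indicator A (y, z)) \<partial>M)"
        using z by (intro nn_integral_cmult[symmetric]) measurable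
      also have "\<dots> = (\<integral>\<^sup>+y. ennreal (?g (y, z)) * indicator A (y, z) \<partial>M)"
        using z marginal_nonneg[OF t1 z] q_nonneg[OF t0 z]
        by (intro nn_integral_cong) (simp add: ennreal_mult mult.assoc)
      finally show "ennreal (marginal (t - 1) z) * ?k z = \<dots>" .
    qed
    \<comment> \<open>The earlier state is the second component of the pair, so Tonelli's theorem is
      used with the second variable outermost.\<close>
    also have "\<dots> = (\<integral>\<^sup>+w. ennreal (?g w) * indicator A w \<partial>(M \<Otimes>\<^sub>M M))"
      by (rule P.nn_integral_snd) measurable
    also have "\<dots> = emeasure (density (M \<Otimes>\<^sub>M M) (\<lambda>w. ennreal (?g w))) A"
      by (rule emeasure_density[symmetric]) measurable
    finally show "emeasure ?D A = \<dots>" .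
  qed simp
  have "AE w in M \<Otimes>\<^sub>M M. ennreal (pair_marginal t (snd w) (fst w)) = ennreal (?g w)"
    by (rule P.density_unique[OF _ _ eq]) measurable
  then have "AE w in M \<Otimes>\<^sub>M M. pair_marginal t (snd w) (fst w) = ?g w"
    using AE_space
  proof eventually_elim
    case (elim w)
    then have "fst w \<in> space M" "snd w \<in> space M" by (auto simp: space_pair_measure)
    then show ?case
      using elim pair_marginal_nonneg[OF t] marginal_nonneg[OF t1] q_nonneg[OF t0] by simp
  qed
  then have "AE w in density (M \<Otimes>\<^sub>M M) (\<lambda>w. ennreal (pair_marginal t (snd w) (fst w))).
      pair_marginal t (snd w) (fst w) = ?g w"
    by (subst AE_density) auto
  from AE_path_law_pair_marginal[OF t this] show ?thesis by simp
qed

text \<open>Disintegration of the pair law along the later state. Multiplying the quotient by the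
  marginal recovers the pair marginal except where the marginal is 0, and there the pair marginal
  vanishes almost everywhere too.\<close>

lemma distr_pair_posterior:
  assumes t: "t \<in> {2..T}"
  shows "distr (path_law T) (M \<Otimes>\<^sub>M M) (\<lambda>x. (x t, x (t - 1))) =
      density (M \<Otimes>\<^sub>M M) (\<lambda>w. ennreal (marginal t (fst w) * posterior t (fst w) (snd w)))"
proof -
  have t0: "t \<in> {1..T}" using t by auto
  note [measurable] = measurable_marginal[OF t0] measurable_pair_marginal[OF t]
  \<comment> \<open>The marginal is positive almost surely under the pair law; hence almost
    everywhere a positive pair density forces a positive marginal.\<close>
  have "AE w in distr (path_law T) (M \<Otimes>\<^sub>M M) (\<lambda>x. (x t, x (t - 1))). 0 < marginal t (fst w)"
    using AE_marginal_pos[OF t0] by (subst AE_distr_iff[OF measurable_path_law_pair[OF t]]) auto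
  then have "AE w in M \<Otimes>\<^sub>M M. 0 < pair_marginal t (snd w) (fst w) \<longrightarrow> 0 < marginal t (fst w)"
    unfolding distr_pair_marginal[OF t] by (subst (asm) AE_density) auto
  then have "AE w in M \<Otimes>\<^sub>M M. pair_marginal t (snd w) (fst w) =
      marginal t (fst w) * posterior t (fst w) (snd w)"
    using AE_space
  proof eventually_elim
    case (elim w)
    then show ?case using pair_marginal_nonneg[OF t, of "fst w" "snd w"]
      by (cases "marginal t (fst w) = 0") (auto simp: forward_posterior_def space_pair_measure)
  qed
  then show ?thesis
    unfolding distr_pair_marginal[OF t] by (intro density_cong) (auto simp: forward_posterior_def)
qed

text \<open>All exceptional null sets are collected first; the rest is a pointwise induction at a
  fixed path, in which each transition trades the leading marginal for the next one times a
  posterior.\<close>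

lemma AE_path_density_eq:
  assumes "1 \<le> T"
  shows "AE x in path_law T. path_density T x =
    marginal T (x T) * (\<Prod>t=2..T. posterior t (x t) (x (t - 1)))"
proof -
  have "AE x in path_law T. \<forall>t\<in>{2..T}. pair_marginal t (x (t - 1)) (x t) =
    marginal (t - 1) (x (t - 1)) * q t (x (t - 1)) (x t)"
    by (intro AE_finite_allI AE_pair_marginal) auto
  moreover have "AE x in path_law T. \<forall>t\<in>{1..T}. 0 < marginal t (x t)"
    by (intro AE_finite_allI AE_marginal_pos) auto
  ultimately show ?thesis
    using AE_marginal_1[OF assms]
  proof eventually_elim
    case (elim x)
    have step: "marginal t (x t) * posterior t (x t) (x (t - 1)) =
        marginal (t - 1) (x (t - 1)) * q t (x (t - 1)) (x t)" if "t \<in> {2..T}" for t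
    proof -
      have "0 < marginal t (x t)" using elim(2) that by auto
      then show ?thesis using elim(1) that by (simp add: forward_posterior_def)
    qed
    \<comment> \<open>Generalised to prefixes of length \<open>n\<close>, while the marginals and
      posteriors remain those of the full chain of length \<open>T\<close>.\<close>
    have "path_density n x = marginal n (x n) * (\<Prod>t=2..n. posterior t (x t) (x (t - 1)))"
      if "1 \<le> n" "n \<le> T" for n
      using that
    proof (induction n rule: dec_induct)
      case base
      then show ?case using elim by (simp add: path_density_def forward_joint_def)
    next
      case (step n)
      have "path_density (Suc n) x = path_density n x * q (Suc n) (x n) (x (Suc n))"
        using path_density_Suc_upd[of n x "x (Suc n)"] step by simp
      also have "\<dots> = (marginal n (x n) * q (Suc n) (x n) (x (Suc n))) *
          (\<Prod>t=2..n. posterior t (x t) (x (t - 1)))"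
        using step by simp
      also have "marginal n (x n) * q (Suc n) (x n) (x (Suc n)) =
          marginal (Suc n) (x (Suc n)) * posterior (Suc n) (x (Suc n)) (x n)"
        using \<open>\<And>t. t \<in> {2..T} \<Longrightarrow> _\<close>[of "Suc n"] step by simp
      finally show ?case using step by (simp add: mult.assoc mult.commute)
    qed
    then show ?case using assms by simp
  qed
qed

subsection \<open>The bound\<close>

lemma neg_ln_model_likelihood_le:
  assumes T: "2 \<le> T" and p: "prob_density M p"
    and r: "\<And>t. t \<in> {1..T} \<Longrightarrow> transition_density M (r t)"
    and wd: "bound_well_defined M q p r T x0"
  shows "- ln (model_likelihood M p r T x0) \<le> loss_T M q p T x0 + loss_diff M q r T x0 + loss_0 M q r T x0"
proof -
  let ?N = "Pi\<^sub>M {1..T} (\<lambda>_. M)"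
  define R where "R x = reverse_joint p r T (x(0 := x0))" for x
  let ?L = "\<lambda>t w. ln (posterior t (fst w) (snd w) / r t (fst w) (snd w))"
  have T1: "1 \<in> {1..T}" "T \<in> {1..T}" "1 \<le> T" using T by auto
  have sf: "sigma_finite_measure M" ..
  have intR: "integrable ?N R" and KT: "KL_exists M (marginal T) p"
    and Kt: "\<And>t. t \<in> {2..T} \<Longrightarrow> AE y in density M (\<lambda>y. ennreal (marginal t y)). KL_exists M (posterior t y) (r t y)"
    and Et: "\<And>t. t \<in> {2..T} \<Longrightarrow> expect_exists M (marginal t) (\<lambda>y. KL M (posterior t y) (r t y))"
    and r1: "AE y in density M (\<lambda>y. ennreal (marginal 1 y)). 0 < r 1 y x0"
    and E0: "integrable (density M (\<lambda>y. ennreal (marginal 1 y))) (\<lambda>y. - ln (r 1 y x0))"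
    using wd by (auto simp: bound_well_defined_def R_def[abs_def] expect_exists_def)
  have [measurable]: "p \<in> borel_measurable M" and p0: "\<And>y. y \<in> space M \<Longrightarrow> 0 \<le> p y"
    using p by (auto simp: prob_density_def)
  have r0: "0 \<le> r t y z" if "t \<in> {1..T}" "y \<in> space M" "z \<in> space M" for t y z
    using r[OF that(1)] that by (auto simp: transition_density_def prob_density_def)
  note [measurable] = measurable_marginal[OF T1(2)]
  have R_nonneg: "0 \<le> R x" if "x \<in> space ?N" for x
    unfolding R_def reverse_joint_def
    by (intro mult_nonneg_nonneg prod_nonneg ballI p0 r0 coordinate_in_space[OF _ that]) auto

  have int_T: "integrable (path_law T) (\<lambda>x. ln (marginal T (x T) / p (x T)))"
    and exp_T: "(\<integral>x. ln (marginal T (x T) / p (x T)) \<partial>path_law T) = loss_T M q p T x0"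
  proof -
    have m0: "AE y in M. 0 \<le> marginal T y" using marginal_nonneg[OF T1(2)] by auto
    have "integrable M (\<lambda>y. marginal T y * ln (marginal T y / p y))"
      using KT by (simp add: KL_exists_def)
    then have "integrable (distr (path_law T) M (\<lambda>x. x T)) (\<lambda>y. ln (marginal T y / p y))"
      unfolding distr_marginal[OF T1(2)] using m0 by (subst integrable_real_density) auto
    then show "integrable (path_law T) (\<lambda>x. ln (marginal T (x T) / p (x T)))"
      by (rule integrable_distr[OF measurable_path_law_component[OF T1(2)]])
    have "(\<integral>x. ln (marginal T (x T) / p (x T)) \<partial>path_law T) =
        (\<integral>y. ln (marginal T y / p y) \<partial>distr (path_law T) M (\<lambda>x. x T))"
      by (rule integral_distr[OF measurable_path_law_component[OF T1(2)], symmetric]) measurable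
    also have "\<dots> = (\<integral>y. marginal T y * ln (marginal T y / p y) \<partial>M)"
      unfolding distr_marginal[OF T1(2)] using m0 by (subst integral_real_density) auto
    also have "\<dots> = loss_T M q p T x0"
      unfolding loss_T_def using marginal_nonneg[OF T1(2)] p0 KT
      by (intro KL_eq_integral[symmetric] sf) auto
    finally show "(\<integral>x. ln (marginal T (x T) / p (x T)) \<partial>path_law T) = loss_T M q p T x0" .
  qed

  have int_t: "integrable (path_law T) (\<lambda>x. ?L t (x t, x (t - 1)))"
    and exp_t: "(\<integral>x. ?L t (x t, x (t - 1)) \<partial>path_law T) =
      expect M (marginal t) (\<lambda>y. KL M (posterior t y) (r t y))"
    and pos_t: "AE x in path_law T. 0 < r t (x t) (x (t - 1))" if t: "t \<in> {2..T}" for t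
  proof -
    have t0: "t \<in> {1..T}" using t by auto
    \<comment> \<open>Instantiated with the marginal, the posterior and the reverse kernel; folding
      replaces the product density by the law of \<open>(x t, x (t - 1))\<close>, from which
      everything is pulled back to paths.\<close>
    note * = expect_KL_eq_integral_density_pair[OF sf prob_density_marginal[OF t0] measurable_posterior[OF t]
        posterior_nonneg[OF t] r[OF t0] Kt[OF t] Et[OF t], folded distr_pair_posterior[OF t]]
    note X = measurable_path_law_pair[OF t]
    show "integrable (path_law T) (\<lambda>x. ?L t (x t, x (t - 1)))"
      using integrable_distr[OF X *(2)] .
    have "?L t \<in> borel_measurable (M \<Otimes>\<^sub>M M)"
      using borel_measurable_integrable[OF *(2)] by simp
    then show "(\<integral>x. ?L t (x t, x (t - 1)) \<partial>path_law T) =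
        expect M (marginal t) (\<lambda>y. KL M (posterior t y) (r t y))"
      using integral_distr[OF X, of "?L t"] *(3) by simp
    show "AE x in path_law T. 0 < r t (x t) (x (t - 1))"
      using AE_distrD[OF X *(1)] by simp
  qed

  have int_0: "integrable (path_law T) (\<lambda>x. - ln (r 1 (x 1) x0))"
    and exp_0: "(\<integral>x. - ln (r 1 (x 1) x0) \<partial>path_law T) = loss_0 M q r T x0"
  proof -
    note X = measurable_path_law_component[OF T1(1)]
    show "integrable (path_law T) (\<lambda>x. - ln (r 1 (x 1) x0))"
      by (rule integrable_distr[OF X]) (use E0 in \<open>simp only: distr_marginal[OF T1(1)]\<close>)
    have "(\<lambda>y. - ln (r 1 y x0)) \<in> borel_measurable M"
      using borel_measurable_integrable[OF E0] by simp
    from integral_distr[OF X this] show "(\<integral>x. - ln (r 1 (x 1) x0) \<partial>path_law T) = loss_0 M q r T x0"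
      unfolding distr_marginal[OF T1(1)] loss_0_def expect_def by simp
  qed

  \<comment> \<open>Absolute continuity in \<open>KL_exists\<close> makes \<open>p\<close> positive
    wherever the final marginal is, up to a null set.\<close>
  have "AE y in density M (\<lambda>y. ennreal (marginal T y)). 0 < p y"
  proof (subst AE_density)
    show "AE y in M. 0 < ennreal (marginal T y) \<longrightarrow> 0 < p y"
      using KT[unfolded KL_exists_def, THEN conjunct1] AE_space
      by eventually_elim (use p0 in force)
  qed measurable
  then have pos_p: "AE x in path_law T. 0 < p (x T)"
    by (rule AE_path_law_marginal[OF T1(2)])
  have pos_r1: "AE x in path_law T. 0 < r 1 (x 1) x0"
    using r1 by (rule AE_path_law_marginal[OF T1(1)])
  have pos_r: "AE x in path_law T. \<forall>t\<in>{2..T}. 0 < r t (x t) (x (t - 1))"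
    using pos_t by (intro AE_finite_allI) auto

  \<comment> \<open>The factor \<open>t = 1\<close> is split off because only it sees the pinned
    state \<open>x0\<close>.\<close>
  have R_eq: "R x = p (x T) * (r 1 (x 1) x0 * (\<Prod>t=2..T. r t (x t) (x (t - 1))))" for x
  proof -
    have "(\<Prod>t=1..T. r t ((x(0 := x0)) t) ((x(0 := x0)) (t - 1))) =
        r 1 ((x(0 := x0)) 1) ((x(0 := x0)) (1 - 1)) * 
        (\<Prod>t=Suc 1..T. r t ((x(0 := x0)) t) ((x(0 := x0)) (t - 1)))"
      using T by (intro prod.atLeast_Suc_atMost) auto
    also have "(\<Prod>t=Suc 1..T. r t ((x(0 := x0)) t) ((x(0 := x0)) (t - 1))) =
        (\<Prod>t=2..T. r t (x t) (x (t - 1)))"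
      by (intro prod.cong) auto
    finally show ?thesis using T by (simp add: R_def reverse_joint_def)
  qed

  have R_pos: "AE x in path_law T. 0 < R x"
    using pos_p pos_r1 pos_r
    by eventually_elim (auto simp: R_eq intro!: mult_pos_pos prod_pos)

  let ?S = "\<lambda>x. ln (marginal T (x T) / p (x T)) + (\<Sum>t=2..T. ?L t (x t, x (t - 1))) + - ln (r 1 (x 1) x0)"
  have ln_eq: "AE x in path_law T. ln (path_density T x / R x) = ?S x"
    using pos_p pos_r1 pos_r AE_path_density_eq[OF T1(3)] AE_path_density_pos AE_marginal_pos[OF T1(2)] AE_space
  proof eventually_elim
    case (elim x)
    have x: "x t \<in> space M" if "t \<in> {1..T}" for t
      using elim(7) that by (auto simp: space_path_law space_PiM)
    \<comment> \<open>A positive path density rules out a vanishing factor, so the nonnegative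
      posteriors are all positive and the logarithm of the product splits into a sum.\<close>
    have "(\<Prod>t=2..T. posterior t (x t) (x (t - 1))) \<noteq> 0"
      using elim(4,5) by (metis less_irrefl mult_zero_right)
    then have post: "0 < posterior t (x t) (x (t - 1))" if "t \<in> {2..T}" for t
    proof -
      have "t \<in> {1..T}" "t - 1 \<in> {1..T}" using that by auto
      from posterior_nonneg[OF that x[OF this(1)] x[OF this(2)]] show ?thesis
        using \<open>(\<Prod>t=2..T. posterior t (x t) (x (t - 1))) \<noteq> 0\<close> that by (simp add: less_le)
    qed
    have "ln (path_density T x) = ln (marginal T (x T)) + (\<Sum>t=2..T. ln (posterior t (x t) (x (t - 1))))"
    proof -
      have "0 < (\<Prod>t=2..T. posterior t (x t) (x (t - 1)))"
        using post by (intro prod_pos) auto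
      moreover have "ln (\<Prod>t=2..T. posterior t (x t) (x (t - 1))) =
          (\<Sum>t=2..T. ln (posterior t (x t) (x (t - 1))))"
        using post by (intro ln_prod) force+
      ultimately show ?thesis using elim(4,6) by (simp add: ln_mult del: prod_zero_iff)
    qed
    moreover have "ln (R x) = ln (p (x T)) + (ln (r 1 (x 1) x0) + (\<Sum>t=2..T. ln (r t (x t) (x (t - 1)))))"
    proof -
      have "0 < (\<Prod>t=2..T. r t (x t) (x (t - 1)))"
        using elim(3) by (intro prod_pos) auto
      moreover have "ln (\<Prod>t=2..T. r t (x t) (x (t - 1))) = (\<Sum>t=2..T. ln (r t (x t) (x (t - 1))))"
        using elim(3) by (intro ln_prod) force+
      ultimately show ?thesis using elim(1,2) by (simp add: R_eq ln_mult del: prod_zero_iff)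
    qed
    moreover have "(\<Sum>t=2..T. ?L t (x t, x (t - 1))) =
        (\<Sum>t=2..T. ln (posterior t (x t) (x (t - 1)))) - (\<Sum>t=2..T. ln (r t (x t) (x (t - 1))))"
      unfolding sum_subtractf[symmetric]
    proof (intro sum.cong refl)
      fix t assume "t \<in> {2..T}"
      then have "0 < posterior t (x t) (x (t - 1))" "0 < r t (x t) (x (t - 1))"
        using post elim(3) by auto
      then show "?L t (x t, x (t - 1)) = ln (posterior t (x t) (x (t - 1))) - ln (r t (x t) (x (t - 1)))"
        by (simp add: ln_div)
    qed
    moreover have "0 < R x" unfolding R_eq using elim by (auto intro!: mult_pos_pos prod_pos)
    then have "ln (path_density T x / R x) = ln (path_density T x) - ln (R x)"
      using elim(5) by (simp add: ln_div)
    moreover have "ln (marginal T (x T) / p (x T)) = ln (marginal T (x T)) - ln (p (x T))"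
      using elim(1,6) by (simp add: ln_div)
    ultimately show ?case by linarith
  qed

  have int_S: "integrable (path_law T) ?S"
    using int_T int_t int_0 by (intro Bochner_Integration.integrable_add Bochner_Integration.integrable_sum) auto
  \<comment> \<open>The log-ratio equals \<open>?S\<close> only almost surely, so its measurability
    is established separately before integrability and the integral are transferred.\<close>
  have meas: "(\<lambda>x. ln (path_density T x / R x)) \<in> borel_measurable (path_law T)"
    using measurable_path_density[of T] borel_measurable_integrable[OF intR] by (simp add: path_law_def)
  have "integrable (path_law T) (\<lambda>x. ln (path_density T x / R x))"
    using int_S by (subst integrable_cong_AE[OF meas _ ln_eq]) (auto dest: borel_measurable_integrable)
  \<comment> \<open>Here \<open>R\<close> is the reverse joint density with \<open>x0\<close> fixed,
    an unnormalised density in the latent path whose integral is the model likelihood.\<close>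
  then have "- ln (\<integral>x. R x \<partial>?N) \<le> (\<integral>x. ln (path_density T x / R x) \<partial>path_law T)"
    using measurable_path_density[of T] borel_measurable_integrable[OF intR] path_density_nonneg[of T]
      R_nonneg prob_space_path_law[of T] intR R_pos
    unfolding path_law_def by (intro neg_ln_integral_le) auto
  also have "\<dots> = (\<integral>x. ?S x \<partial>path_law T)"
    using int_S by (intro integral_cong_AE[OF meas _ ln_eq]) (auto dest: borel_measurable_integrable)
  also have "\<dots> = loss_T M q p T x0 + loss_diff M q r T x0 + loss_0 M q r T x0"
  proof -
    have int_sum: "integrable (path_law T) (\<lambda>x. \<Sum>t=2..T. ?L t (x t, x (t - 1)))"
      by (rule Bochner_Integration.integrable_sum) (rule int_t)
    have "(\<integral>x. (\<Sum>t=2..T. ?L t (x t, x (t - 1))) \<partial>path_law T) = loss_diff M q r T x0"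
      unfolding loss_diff_def
      by (subst Bochner_Integration.integral_sum, rule int_t, assumption) (intro sum.cong refl exp_t)
    then show ?thesis
      using exp_T exp_0
      unfolding Bochner_Integration.integral_add[OF Bochner_Integration.integrable_add[OF int_T int_sum] int_0]
        Bochner_Integration.integral_add[OF int_T int_sum] by (simp only:)
  qed
  finally show ?thesis by (simp add: model_likelihood_def R_def)
qed

end

text \<open>In the discrete case the space is finite, so counting measure qualifies; in the
  continuous case it is a finite product of Lebesgue measures.\<close>

lemma sigma_finite_state_measure:
  assumes "state_measure d M"
  shows "sigma_finite_measure M"
proof -
  interpret product_sigma_finite "\<lambda>_::nat. lborel :: real measure" ..
  have "finite ({..<d} \<rightarrow>\<^sub>E real ` {1..K})" for K :: nat
    by (intro finite_PiE) auto
  then show ?thesis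
    using assms sigma_finite[of "{..<d}"]
    by (auto simp: state_measure_def intro: sigma_finite_measure_count_space_finite)
qed

theorem mainTheorem1:
  fixes d T :: nat
    and M :: "(nat \<Rightarrow> real) measure"
    and q :: "nat \<Rightarrow> (nat \<Rightarrow> real) \<Rightarrow> (nat \<Rightarrow> real) \<Rightarrow> real"
    and p :: "(nat \<Rightarrow> real) \<Rightarrow> real"
    and p_rev :: "'p \<Rightarrow> nat \<Rightarrow> (nat \<Rightarrow> real) \<Rightarrow> (nat \<Rightarrow> real) \<Rightarrow> real"
    and \<theta> :: 'p
    and x0 :: "nat \<Rightarrow> real"
  assumes "T \<ge> 2"
    and "state_measure d M"
    and "\<And>t. t \<in> {1..T} \<Longrightarrow> transition_density M (q t)"
    and "prob_density M p"
    and "\<And>t. t \<in> {1..T} \<Longrightarrow> transition_density M (p_rev \<theta> t)"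
    and "x0 \<in> space M"
    and "bound_well_defined M q p (p_rev \<theta>) T x0"
  shows "- ln (model_likelihood M p (p_rev \<theta>) T x0)
           \<le> loss_T M q p T x0 + loss_diff M q (p_rev \<theta>) T x0 + loss_0 M q (p_rev \<theta>) T x0"
proof -
  interpret sigma_finite_measure M
    using assms(2) by (rule sigma_finite_state_measure)
  interpret forward_process M q T x0
    using assms(3,6) by unfold_locales
  show ?thesis
    using assms(1,4,5,7) by (rule neg_ln_model_likelihood_le)
qed

end
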